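(* Let $A$ and $E$ be $N \times n$ real matrices, where $A$ is deterministic with rank $r \geq 1$ and the entries of $E$ are jointly independent standard Gaussian random variables. Let $\widetilde A=A+E$. Let $K$ be an arbitrary positive constant, and denote $\eta:= 54 r\sqrt{(K+8) \log (N+n)}$. If $\sigma_{1} \ge 4(\sqrt N+ \sqrt{n}) + 140\eta r$ and $\delta_{1} = \sigma_{1} - \sigma_{2}\geq 100\eta r$, then with probability at least $1 - 15 (N+n)^{-K}$ \[ \sin \angle(u_1,\widetilde u_1) \le 54^2\sqrt{K+8}\,\frac{ r \sqrt{\log(N+n)}}{\delta_1} +2\frac{\|E\|}{\sigma_1} \] whenever $\frac{(\sqrt N+\sqrt n)^2}{\log(N+n)}>64(K+9)$. The same bound holds for $\sin \angle(v_1,\widetilde v_1)$.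
   Context: $\sigma_1\ge\sigma_2\ge\cdots\ge\sigma_r>0$ are the non-zero singular values of $A$, and $\sigma_{r+i}=0$ for $i\ge 1$. $u_1,v_1$ are the unit left and right singular vectors of $A$ corresponding to $\sigma_1$; $\widetilde u_1,\widetilde v_1$ are the unit left and right singular vectors of $\widetilde A$ corresponding to its largest singular value. $\|E\|$ is the spectral norm, $\log$ is the natural logarithm, and $\angle(x,y)\in[0,\pi/2]$ is the acute angle between (the lines spanned by) $x$ and $y$. *)

theory Defs
  imports "HOL-Probability.Probability"
begin

text \<open>
  For \<open>s > 0\<close>, \<open>s\<close> is a singular value of \<open>A\<close> iff \<open>s\<^sup>2\<close> is an eigenvalue of \<open>A\<^sup>T A\<close>. Since \<open>A\<^sup>T A\<close>
  is symmetric, the multiplicity of \<open>s\<close> is the dimension of the corresponding eigenspace.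
\<close>

definition gram_eigenspace :: "real^'n^'m \<Rightarrow> real \<Rightarrow> (real^'n) set" where
  "gram_eigenspace A t = {v. (transpose A ** A) *v v = t *\<^sub>R v}"

definition nonzero_singular_values :: "real^'n^'m \<Rightarrow> real set" where
  "nonzero_singular_values A = {s. s > 0 \<and> (\<exists>v \<in> gram_eigenspace A (s\<^sup>2). v \<noteq> 0)}"

lemma finite_nonzero_singular_values: "finite (nonzero_singular_values A)"
proof -
  let ?S = "nonzero_singular_values A"
  define f where "f s = (SOME v. v \<in> gram_eigenspace A (s\<^sup>2) \<and> v \<noteq> 0)" for s
  have f: "(transpose A ** A) *v f s = s\<^sup>2 *\<^sub>R f s" "f s \<noteq> 0" if "s \<in> ?S" for s
  proof -
    have "f s \<in> gram_eigenspace A (s\<^sup>2) \<and> f s \<noteq> 0"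
      unfolding f_def by (rule someI_ex) (use that in \<open>auto simp: nonzero_singular_values_def\<close>)
    then show "(transpose A ** A) *v f s = s\<^sup>2 *\<^sub>R f s" "f s \<noteq> 0"
      by (auto simp: gram_eigenspace_def)
  qed
  have orth: "f s \<bullet> f t = 0" if "s \<in> ?S" "t \<in> ?S" "s \<noteq> t" for s t
  proof -
    have "s\<^sup>2 * (f s \<bullet> f t) = ((transpose A ** A) *v f s) \<bullet> f t"
      using f(1)[OF that(1)] by simp
    also have "\<dots> = f s \<bullet> ((transpose A ** A) *v f t)"
      by (metis dot_lmul_matrix matrix_transpose_mul transpose_matrix_vector transpose_transpose)
    also have "\<dots> = t\<^sup>2 * (f s \<bullet> f t)"
      using f(1)[OF that(2)] by simp
    finally have "(s\<^sup>2 - t\<^sup>2) * (f s \<bullet> f t) = 0"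
      by (simp add: algebra_simps)
    moreover have "s\<^sup>2 \<noteq> t\<^sup>2"
      using that by (auto simp: nonzero_singular_values_def power2_eq_iff)
    ultimately show ?thesis by simp
  qed
  have "inj_on f ?S"
    by (rule inj_onI) (metis f(2) inner_eq_zero_iff orth)
  moreover have "pairwise orthogonal (f ` ?S)"
    unfolding pairwise_def orthogonal_def using orth by (metis imageE)
  then have "finite (f ` ?S)"
    by (rule pairwise_orthogonal_imp_finite)
  ultimately show ?thesis
    using finite_imageD by blast
qed

definition singular_value_mset :: "real^'n^'m \<Rightarrow> real multiset" where
  "singular_value_mset A =
     (\<Sum>s\<in>nonzero_singular_values A. replicate_mset (dim (gram_eigenspace A (s\<^sup>2))) s)"

text \<open>\<open>singular_value A k\<close> is \<open>\<sigma>\<^sub>k(A)\<close>: indices start at \<open>1\<close>, and \<open>\<sigma>\<^sub>k(A) = 0\<close> beyond the rank.\<close>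

definition singular_value :: "real^'n^'m \<Rightarrow> nat \<Rightarrow> real" where
  "singular_value A k =
     (let xs = rev (sorted_list_of_multiset (singular_value_mset A))
      in if 1 \<le> k \<and> k \<le> length xs then xs ! (k - 1) else 0)"

definition unit_singular_vectors :: "real^'n^'m \<Rightarrow> real \<Rightarrow> real^'m \<Rightarrow> real^'n \<Rightarrow> bool" where
  "unit_singular_vectors A s u v \<longleftrightarrow>
     norm u = 1 \<and> norm v = 1 \<and> A *v v = s *\<^sub>R u \<and> transpose A *v u = s *\<^sub>R v"

definition spectral_norm :: "real^'n^'m \<Rightarrow> real" where
  "spectral_norm A = onorm ((*v) A)"

definition line_angle :: "'a::real_inner \<Rightarrow> 'a \<Rightarrow> real" where
  "line_angle x y = arccos (\<bar>x \<bullet> y\<bar> / (norm x * norm y))"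

definition standard_gaussian_matrix :: "'w measure \<Rightarrow> ('w \<Rightarrow> real^'n^'m) \<Rightarrow> bool" where
  "standard_gaussian_matrix M E \<longleftrightarrow>
     prob_space.indep_vars M (\<lambda>_. borel) (\<lambda>(i, j) \<omega>. E \<omega> $ i $ j) UNIV \<and>
     (\<forall>i j. distributed M lborel (\<lambda>\<omega>. E \<omega> $ i $ j) std_normal_density)"

text \<open>
  The property itself need not be a measurable event; it only has to contain one of
  sufficiently large probability.
\<close>

definition holds_with_prob_at_least :: "'w measure \<Rightarrow> real \<Rightarrow> ('w \<Rightarrow> bool) \<Rightarrow> bool" where
  "holds_with_prob_at_least M p P \<longleftrightarrow> (\<exists>F\<in>sets M. p \<le> measure M F \<and> (\<forall>\<omega>\<in>F. P \<omega>))"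

end

theory Submission
  imports Defs
begin

text \<open>
  If \<open>2 \<parallel>E\<parallel> > \<sigma>\<^sub>1\<close> the right-hand side exceeds \<open>1\<close>, so assume \<open>2 \<parallel>E\<parallel> \<le> \<sigma>\<^sub>1\<close>; no further bound
  on \<open>\<parallel>E\<parallel>\<close> is needed. Pass to the symmetric operators \<open>H\<^sub>A (a, b) = (A b, A\<^sup>T a)\<close> and \<open>H\<^sub>E\<close>, and
  let \<open>Q\<close> project onto the orthogonal complement of (column space) \<open>\<times>\<close> (row space) of \<open>A\<close>. The
  \<open>Q\<close>-part of the top singular pair of \<open>A + E\<close> has norm at most \<open>2 \<parallel>E\<parallel> / \<sigma>\<^sub>1\<close>. Eliminating it leaves a
  Schur complement of size \<open>2 r\<close>, whose entries are Neumann series with terms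
  \<open>H\<^sub>E b \<bullet> (Q H\<^sub>E)\<^sup>k c / z\<^sup>k\<close> at the top singular value \<open>z\<close> of \<open>A + E\<close>. For orthogonal \<open>b\<close> and \<open>c\<close>
  such a term is a Gaussian, linear in one row or column of \<open>E\<close> with coefficients that do not
  depend on it; a union bound over \<open>k\<close> then holds simultaneously for all \<open>z\<close>. Polarization turns
  differences of diagonal entries into such terms. So the Schur complement is \<open>H\<^sub>A\<close> plus a scalar
  on each of the two blocks plus an error of order \<open>sqrt (log (N + n))\<close> per entry. Its largest
  eigenvalue is \<open>z\<close>, which bounds the two scalars in terms of \<open>\<sigma>\<^sub>1\<close>, and the gap \<open>\<sigma>\<^sub>1 - \<sigma>\<^sub>2\<close> bounds
  the part of the singular pair orthogonal to \<open>u\<^sub>1\<close> and \<open>v\<^sub>1\<close>.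
\<close>

section \<open>The two largest singular values\<close>

lemma inner_matrix_vector_mult:
  fixes A :: "real^'n^'m"
  shows "(A *v x) \<bullet> y = x \<bullet> (transpose A *v y)"
  by (metis dot_lmul_matrix inner_commute transpose_matrix_vector)

text \<open>First-order optimality of \<open>v\<close> along the residual \<open>A\<^sup>T A v - t\<^sup>2 v\<close> forces the residual to vanish.\<close>
lemma maximizer_gram_eigenvector:
  fixes A :: "real^'n^'m"
  assumes S: "subspace S" "\<And>x. x \<in> S \<Longrightarrow> (transpose A ** A) *v x \<in> S"
    and v: "v \<in> S" "norm v = 1"
    and max: "\<And>w. w \<in> S \<Longrightarrow> norm (A *v w) \<le> t * norm w"
    and t: "t = norm (A *v v)"
  shows "v \<in> gram_eigenspace A (t\<^sup>2)"
proof -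
  define x where "x = (transpose A ** A) *v v - t\<^sup>2 *\<^sub>R v"
  have x: "x \<in> S"
    unfolding x_def using S v by (intro subspace_diff subspace_scale) auto
  define C where "C = t\<^sup>2 * (norm x)\<^sup>2 - (norm (A *v x))\<^sup>2"
  have gram: "(A *v v) \<bullet> (A *v x) = ((transpose A ** A) *v v) \<bullet> x"
    using inner_matrix_vector_mult[of A x "A *v v"]
    by (simp add: matrix_vector_mul_assoc[symmetric] inner_commute)
  have D: "(A *v v) \<bullet> (A *v x) - t\<^sup>2 * (v \<bullet> x) = (norm x)\<^sup>2"
    unfolding gram by (simp add: x_def power2_norm_eq_inner algebra_simps)
  \<comment> \<open>The maximality of \<open>v\<close> is tested at \<open>v + s x\<close>. Both
    sides are quadratics in \<open>s\<close> that agree at \<open>s = 0\<close>, and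
    \<open>D\<close> evaluates the difference of the linear terms.\<close>
  have ineq: "2 * s * (norm x)\<^sup>2 \<le> s\<^sup>2 * C" for s
  proof -
    have "norm (A *v (v + s *\<^sub>R x)) \<le> t * norm (v + s *\<^sub>R x)"
      using S(1) v x by (intro max subspace_add subspace_scale) auto
    then have "(norm (A *v (v + s *\<^sub>R x)))\<^sup>2 \<le> (t * norm (v + s *\<^sub>R x))\<^sup>2"
      by (rule power_mono) simp
    also have "(norm (A *v (v + s *\<^sub>R x)))\<^sup>2 =
        t\<^sup>2 + 2 * s * ((A *v v) \<bullet> (A *v x)) + s\<^sup>2 * (norm (A *v x))\<^sup>2"
      unfolding t power2_norm_eq_inner
      by (simp add: matrix_vector_right_distrib scaleR_matrix_vector_assoc[symmetric]
          matrix_vector_mult_scaleR algebra_simps inner_commute power2_eq_square)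
    also have "(t * norm (v + s *\<^sub>R x))\<^sup>2 = t\<^sup>2 * (1 + 2 * s * (v \<bullet> x) + s\<^sup>2 * (norm x)\<^sup>2)"
      using v(2) unfolding power_mult_distrib power2_norm_eq_inner norm_eq_1
      by (simp add: algebra_simps inner_commute power2_eq_square)
    finally show ?thesis
      unfolding D[symmetric] C_def by (simp add: algebra_simps)
  qed
  have "C \<ge> 0"
    using max[OF x] by (simp add: C_def power_mult_distrib[symmetric] power_mono)
  have "x = 0"
  proof (rule ccontr)
    assume "x \<noteq> 0"
    then have pos: "(norm x)\<^sup>2 > 0" by simp
    \<comment> \<open>This \<open>s\<close> is so small that the quadratic term cannot compensate
      the linear one; the \<open>+ 1\<close> keeps the denominator positive when
      \<open>C = 0\<close>.\<close>
    define s where "s = (norm x)\<^sup>2 / (C + 1)"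
    have s: "s > 0" "s * C \<le> (norm x)\<^sup>2"
      using pos \<open>C \<ge> 0\<close> by (auto simp: s_def field_simps)
    have "2 * (norm x)\<^sup>2 \<le> s * C"
      using ineq[of s] s(1) by (simp add: power2_eq_square mult.assoc)
    with s pos show False by simp
  qed
  then show ?thesis
    by (simp add: gram_eigenspace_def x_def)
qed

text \<open>The unit sphere of a nonzero subspace is compact and nonempty, so a maximizer exists
  there; homogeneity extends the bound to all of \<open>S\<close>.\<close>

lemma maximizer_exists:
  fixes A :: "real^'n^'m"
  assumes "subspace S" "S \<noteq> {0}"
  shows "\<exists>v\<in>S. norm v = 1 \<and> (\<forall>w\<in>S. norm (A *v w) \<le> norm (A *v v) * norm w)"
proof -
  let ?K = "sphere 0 1 \<inter> S"
  obtain x where x: "x \<in> S" "x \<noteq> 0"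
    using assms subspace_0 by blast
  then have "x /\<^sub>R norm x \<in> ?K"
    using assms(1) by (simp add: subspace_scale)
  moreover have "compact ?K"
    using assms(1) by (intro compact_Int_closed closed_subspace) auto
  moreover have "continuous_on ?K (\<lambda>w. norm (A *v w))"
    by (intro continuous_intros)
  ultimately obtain v where v: "v \<in> ?K" "\<And>w. w \<in> ?K \<Longrightarrow> norm (A *v w) \<le> norm (A *v v)"
    using continuous_attains_sup[of ?K "\<lambda>w. norm (A *v w)"] by blast
  show ?thesis
  proof (intro bexI conjI ballI)
    show "v \<in> S" "norm v = 1" using v(1) by auto
    fix w assume w: "w \<in> S"
    show "norm (A *v w) \<le> norm (A *v v) * norm w"
    proof (cases "w = 0")
      case False
      have "norm (A *v (w /\<^sub>R norm w)) \<le> norm (A *v v)"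
        using w False assms(1) by (intro v(2)) (auto simp: subspace_scale)
      then show ?thesis
        using False by (simp add: matrix_vector_mult_scaleR field_simps)
    qed simp
  qed
qed

lemma count_singular_value_mset:
  "count (singular_value_mset A) s =
    (if s \<in> nonzero_singular_values A then dim (gram_eigenspace A (s\<^sup>2)) else 0)"
proof -
  have "count (singular_value_mset A) s =
      (\<Sum>t\<in>nonzero_singular_values A. if t = s then dim (gram_eigenspace A (t\<^sup>2)) else 0)"
    unfolding singular_value_mset_def count_sum
    by (intro sum.cong) auto
  then show ?thesis
    by (simp add: finite_nonzero_singular_values)
qed

lemma nonzero_singular_value_mem_mset:
  assumes "s > 0" "v \<in> gram_eigenspace A (s\<^sup>2)" "v \<noteq> 0"
  shows "s \<in># singular_value_mset A"
proof -
  have "dim (gram_eigenspace A (s\<^sup>2)) \<noteq> 0"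
    unfolding dim_eq_0 using assms(2,3) by blast
  moreover have "s \<in> nonzero_singular_values A"
    using assms by (auto simp: nonzero_singular_values_def)
  ultimately have "count (singular_value_mset A) s \<noteq> 0"
    by (simp add: count_singular_value_mset)
  then show ?thesis
    by (metis count_eq_zero_iff)
qed

lemma singular_value_nonneg: "singular_value A k \<ge> 0"
proof -
  let ?xs = "rev (sorted_list_of_multiset (singular_value_mset A))"
  have "x \<ge> 0" if "x \<in> set ?xs" for x
  proof -
    have "count (singular_value_mset A) x > 0"
      using that by simp
    then show ?thesis
      by (auto simp: count_singular_value_mset nonzero_singular_values_def split: if_splits)
  qed
  moreover have "?xs ! (k - 1) \<in> set ?xs" if "1 \<le> k" "k \<le> length ?xs"
    using that by (intro nth_mem) linarith
  ultimately show ?thesis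
    unfolding singular_value_def Let_def by (metis order_refl)
qed

lemma singular_value_ge_first:
  assumes "t \<in># singular_value_mset A"
  shows "t \<le> singular_value A 1"
proof -
  let ?ys = "sorted_list_of_multiset (singular_value_mset A)"
  let ?xs = "rev ?ys"
  have "t \<in> set ?xs" using assms by simp
  then obtain i where i: "i < length ?xs" "?xs ! i = t"
    unfolding in_set_conv_nth by blast
  have "sorted_wrt (\<ge>) ?xs"
    by (simp add: sorted_wrt_rev)
  then have "?xs ! i \<le> ?xs ! 0"
    using i(1) sorted_wrt_nth_less[of "(\<ge>)" ?xs 0 i] by (cases i) auto
  then show ?thesis
    using i unfolding singular_value_def Let_def by auto
qed

text \<open>Removing one copy of the largest value leaves the tail of the decreasing list, whose
  head is \<open>singular_value A 2\<close>. Phrasing this by multiset difference takes care of a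
  repeated top value.\<close>

lemma singular_value_ge_second:
  assumes "t \<in># singular_value_mset A - {#singular_value A 1#}"
  shows "t \<le> singular_value A 2"
proof -
  let ?xs = "rev (sorted_list_of_multiset (singular_value_mset A))"
  have mset: "mset ?xs = singular_value_mset A" by simp
  have "?xs \<noteq> []" using assms mset by (metis diff_empty empty_iff mset.simps(1) in_diffD set_mset_empty)
  then obtain x xs where xs: "?xs = x # xs" by (cases ?xs) auto
  then have x: "singular_value A 1 = x"
    unfolding singular_value_def Let_def by simp
  have "singular_value_mset A = {#x#} + mset xs"
    using mset xs by simp
  then have t: "t \<in> set xs"
    using assms x by simp
  then obtain y ys where ys: "xs = y # ys" by (cases xs) auto
  have "sorted_wrt (\<ge>) ?xs"
    by (simp add: sorted_wrt_rev)
  then have "t \<le> y"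
    using t unfolding xs ys by auto
  moreover have "singular_value A 2 = y"
    unfolding singular_value_def Let_def xs ys by simp
  ultimately show ?thesis by simp
qed

text \<open>The maximum of \<open>norm (A *v v)\<close> over unit vectors is attained at an
  eigenvector of the Gram matrix, so it is a singular value or zero.\<close>

lemma norm_matrix_vector_le_singular_value:
  fixes A :: "real^'n^'m"
  shows "norm (A *v w) \<le> singular_value A 1 * norm w"
proof -
  have ne: "(UNIV :: (real^'n) set) \<noteq> {0}"
    using UNIV_not_singleton[of "0 :: real^'n"] by simp
  obtain v where v: "v \<in> UNIV" "norm v = 1"
      "\<And>w. w \<in> UNIV \<Longrightarrow> norm (A *v w) \<le> norm (A *v v) * norm w"
    using maximizer_exists[OF subspace_UNIV ne, of A] by blast
  have "norm (A *v v) \<le> singular_value A 1"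
  proof (cases "norm (A *v v) > 0")
    case True
    have "v \<in> gram_eigenspace A ((norm (A *v v))\<^sup>2)"
      by (rule maximizer_gram_eigenvector[of UNIV]) (use v in auto)
    then show ?thesis
      using True v by (intro singular_value_ge_first nonzero_singular_value_mem_mset) auto
  next
    case False
    then show ?thesis using singular_value_nonneg[of A 1] by linarith
  qed
  then show ?thesis
    using v(3)[of w, OF UNIV_I] by (meson mult_right_mono norm_ge_zero order_trans)
qed

text \<open>The hyperplane orthogonal to \<open>v\<^sub>1\<close> is invariant under the Gram
  matrix, so the maximum over its unit vectors is again zero or a singular value, and it is found
  besides the copy that belongs to \<open>v\<^sub>1\<close>.\<close>

lemma norm_matrix_vector_le_second_singular_value:
  fixes A :: "real^'n^'m"
  assumes uv: "unit_singular_vectors A (singular_value A 1) u\<^sub>1 v\<^sub>1"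
    and w: "w \<bullet> v\<^sub>1 = 0"
  shows "norm (A *v w) \<le> singular_value A 2 * norm w"
proof (cases "w = 0")
  case False
  let ?s = "singular_value A 1"
  let ?S = "{x. v\<^sub>1 \<bullet> x = 0}"
  have v1: "norm v\<^sub>1 = 1" "(transpose A ** A) *v v\<^sub>1 = ?s\<^sup>2 *\<^sub>R v\<^sub>1"
    using uv by (auto simp: unit_singular_vectors_def matrix_vector_mul_assoc[symmetric]
        matrix_vector_mult_scaleR power2_eq_square)
  have S: "subspace ?S" by (rule subspace_hyperplane)
  have ne: "?S \<noteq> {0}"
  proof -
    have "w \<in> ?S" using w inner_commute[of w v\<^sub>1] by simp
    with False show ?thesis by blast
  qed
  have invar: "(transpose A ** A) *v x \<in> ?S" if "x \<in> ?S" for x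
  proof -
    have "v\<^sub>1 \<bullet> ((transpose A ** A) *v x) = ((transpose A ** A) *v v\<^sub>1) \<bullet> x"
      by (simp add: inner_matrix_vector_mult matrix_transpose_mul)
    also have "\<dots> = 0" using that by (simp add: v1)
    finally show ?thesis by simp
  qed
  obtain v where v: "v \<in> ?S" "norm v = 1"
      "\<And>w. w \<in> ?S \<Longrightarrow> norm (A *v w) \<le> norm (A *v v) * norm w"
    using maximizer_exists[OF S ne, of A] by blast
  let ?t = "norm (A *v v)"
  have "?t \<le> singular_value A 2"
  proof (cases "?t > 0")
    case True
    have eig: "v \<in> gram_eigenspace A (?t\<^sup>2)"
      by (rule maximizer_gram_eigenvector[OF S invar]) (use v in auto)
    have mem: "?t \<in># singular_value_mset A"
      using True v eig by (intro nonzero_singular_value_mem_mset[of _ v]) auto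
    have "?t \<in># singular_value_mset A - {#?s#}"
    \<comment> \<open>If the restricted maximum equals \<sigma>_1, then \<open>v\<close> and
      \<open>v\<^sub>1\<close> span a plane in one eigenspace, so a copy survives the
      deletion.\<close>
    proof (cases "?t = ?s")
      case eq: True
      have "{v, v\<^sub>1} \<subseteq> gram_eigenspace A (?t\<^sup>2)"
        using eig v1 eq by (auto simp: gram_eigenspace_def)
      moreover have "independent {v, v\<^sub>1}"
        using v v1 by (intro pairwise_orthogonal_independent)
          (auto simp: pairwise_def orthogonal_def inner_commute)
      moreover have "v \<noteq> v\<^sub>1"
        using v v1 by (auto simp: norm_eq_1)
      ultimately have "2 \<le> dim (gram_eigenspace A (?t\<^sup>2))"
        using independent_card_le_dim[of "{v, v\<^sub>1}" "gram_eigenspace A (?t\<^sup>2)"] by simp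
      then have "count (singular_value_mset A) ?t \<ge> 2"
        using mem by (auto simp: count_singular_value_mset simp flip: count_greater_zero_iff split: if_splits)
      then show ?thesis
        using eq by (simp flip: count_greater_zero_iff)
    next
      case False
      then show ?thesis using mem by (simp add: in_diff_count)
    qed
    then show ?thesis by (rule singular_value_ge_second)
  next
    case False
    then show ?thesis using singular_value_nonneg[of A 2] by linarith
  qed
  moreover have "norm (A *v w) \<le> ?t * norm w"
    using w by (intro v) (simp add: inner_commute)
  ultimately show ?thesis
    by (meson mult_right_mono norm_ge_zero order_trans)
qed simp

section \<open>Neumann series and Schur complement\<close>

text \<open>The map \<open>z - S\<close> is injective because \<open>S\<close> has norm below
  \<open>z\<close>, hence invertible in finite dimension. \<open>D\<close> is the inverse of
  \<open>1 - S / z\<close>.\<close>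

lemma neumann_solution:
  fixes S :: "'a::euclidean_space \<Rightarrow> 'a"
  assumes S: "linear S" and bound: "\<And>p. norm (S p) \<le> e * norm p" and e: "e < z"
  obtains D where "linear D" "\<And>w. z *\<^sub>R (D w - w) = S (D w)"
    "\<And>w p. z *\<^sub>R (p - w) = S p \<Longrightarrow> p = D w"
proof -
  define J where "J p = z *\<^sub>R p - S p" for p
  have J: "linear J"
    unfolding J_def using S by (intro linear_compose_sub linear_scale_self)
  have inj: "inj J"
    unfolding linear_injective_0[OF J]
  proof safe
    fix p assume "J p = 0"
    then have "z *\<^sub>R p = S p" by (simp add: J_def)
    then have "\<bar>z\<bar> * norm p \<le> e * norm p"
      using bound[of p] by (metis norm_scaleR)
    moreover have "(\<bar>z\<bar> - e) > 0" using e by linarith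
    ultimately have "norm p \<le> 0"
      by (metis diff_gt_0_iff_gt linorder_not_le mult_less_cancel_right_disj norm_ge_zero)
    then show "p = 0" by simp
  qed
  obtain J' where J': "linear J'" "J \<circ> J' = id"
    using linear_injective_imp_surjective[OF J inj] linear_surjective_right_inverse[OF J] by blast
  define D where "D w = J' (z *\<^sub>R w)" for w
  have JD: "J (D w) = z *\<^sub>R w" for w
    using J'(2) by (simp add: D_def fun_eq_iff)
  show ?thesis
  proof
    show "linear D"
      unfolding D_def using linear_compose[OF linear_scale_self J'(1)] by (simp add: o_def)
    show "z *\<^sub>R (D w - w) = S (D w)" for w
      using JD[of w] by (simp add: J_def algebra_simps)
    fix w p assume "z *\<^sub>R (p - w) = S p"
    then have "J p = z *\<^sub>R w"
      by (simp add: J_def algebra_simps)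
    then have "J p = J (D w)"
      by (simp add: JD)
    then show "p = D w"
      using inj by (simp add: inj_eq)
  qed
qed

text \<open>Iterating \<open>p = w + S p / z\<close> a finite number of times keeps an exact
  remainder, so the identity involves no convergence.\<close>

lemma neumann_expansion:
  fixes S :: "'a::real_vector \<Rightarrow> 'a"
  assumes S: "linear S" and p: "z *\<^sub>R (p - w) = S p" and z: "z \<noteq> 0"
  shows "p = (\<Sum>k<m. (1 / z ^ k) *\<^sub>R (S ^^ k) w) + (1 / z ^ m) *\<^sub>R (S ^^ m) p"
proof (induction m)
  case (Suc m)
  have pw: "p = w + (1 / z) *\<^sub>R S p"
    using z by (simp flip: p)
  have lin: "linear (S ^^ m)"
    using S by (induction m) (auto simp: linear_id linear_compose)
  have "(S ^^ m) p = (S ^^ m) w + (1 / z) *\<^sub>R (S ^^ m) (S p)"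
    by (subst pw) (simp add: linear_add[OF lin] linear_scale[OF lin])
  then have "(1 / z ^ m) *\<^sub>R (S ^^ m) p =
      (1 / z ^ m) *\<^sub>R (S ^^ m) w + (1 / z ^ Suc m) *\<^sub>R (S ^^ Suc m) p"
    unfolding funpow_Suc_right o_apply by (simp add: scaleR_add_right mult.commute)
  with Suc show ?case by (simp add: add.assoc)
qed simp

text \<open>Two rates play different roles: \<open>s\<close> controls the probed terms and yields
  the geometric sum, while \<open>e\<close> only drives the remainder to zero. The probed terms will
  be known with \<open>s = 3/2 * e\<close>.\<close>

lemma inner_neumann_le:
  fixes S :: "'a::real_inner \<Rightarrow> 'a"
  assumes S: "linear S" and bound: "\<And>p. norm (S p) \<le> e * norm p"
    and e: "0 \<le> e" "e < z" and s: "0 \<le> s" "s < z"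
    and p: "z *\<^sub>R (p - w) = S p"
    and f: "\<And>k. \<bar>f \<bullet> (S ^^ k) w\<bar> \<le> a * s ^ k"
  shows "\<bar>f \<bullet> p\<bar> \<le> a / (1 - s / z)"
proof -
  have z: "z > 0" using e by simp
  have a: "a \<ge> 0" using f[of 0] by (smt (verit) mult_cancel_left2 power_0)
  have pow: "norm ((S ^^ m) q) \<le> e ^ m * norm q" for m q
  proof (induction m)
    case (Suc m)
    have "norm ((S ^^ Suc m) q) \<le> e * norm ((S ^^ m) q)"
      using bound by simp
    also have "\<dots> \<le> e * (e ^ m * norm q)"
      using Suc e by (intro mult_left_mono)
    finally show ?case by simp
  qed simp
  have le: "\<bar>f \<bullet> p\<bar> \<le> a / (1 - s / z) + norm f * norm p * (e / z) ^ m" for m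
  proof -
    have "f \<bullet> p = (\<Sum>k<m. (f \<bullet> (S ^^ k) w) / z ^ k) + f \<bullet> ((1 / z ^ m) *\<^sub>R (S ^^ m) p)"
      by (subst neumann_expansion[OF S p, of m]) (use z in \<open>simp_all add: inner_add_right inner_sum_right\<close>)
    also have "\<bar>\<dots>\<bar> \<le> (\<Sum>k<m. \<bar>f \<bullet> (S ^^ k) w\<bar> / z ^ k) + norm f * norm ((1 / z ^ m) *\<^sub>R (S ^^ m) p)"
    proof -
      have "\<bar>\<Sum>k<m. (f \<bullet> (S ^^ k) w) / z ^ k\<bar> \<le> (\<Sum>k<m. \<bar>f \<bullet> (S ^^ k) w\<bar> / z ^ k)"
        by (rule order_trans[OF sum_abs]) (use z in \<open>simp add: abs_divide\<close>)
      then show ?thesis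
        using Cauchy_Schwarz_ineq2[of f "(1 / z ^ m) *\<^sub>R (S ^^ m) p"] by linarith
    qed
    also have "\<dots> \<le> (\<Sum>k<m. a * (s / z) ^ k) + norm f * (norm p * (e / z) ^ m)"
    proof (intro add_mono sum_mono mult_left_mono)
      show "\<bar>f \<bullet> (S ^^ k) w\<bar> / z ^ k \<le> a * (s / z) ^ k" for k
        using f[of k] z by (simp add: power_divide divide_right_mono)
      show "norm ((1 / z ^ m) *\<^sub>R (S ^^ m) p) \<le> norm p * (e / z) ^ m"
        using pow[of m p] z by (simp add: power_divide field_simps)
    qed simp
    also have "(\<Sum>k<m. a * (s / z) ^ k) \<le> a / (1 - s / z)"
    proof -
      have "(\<Sum>k<m. (s / z) ^ k) \<le> (\<Sum>k. (s / z) ^ k)"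
        using s z by (intro sum_le_suminf summable_geometric) auto
      also have "\<dots> = 1 / (1 - s / z)"
        using s z by (intro suminf_geometric) auto
      finally show ?thesis
        using mult_left_mono[OF _ a] by (fastforce simp: sum_distrib_left[symmetric])
    qed
    finally show ?thesis by (simp add: mult.assoc)
  qed
  have "(\<lambda>m. a / (1 - s / z) + norm f * norm p * (e / z) ^ m) \<longlonglongrightarrow> a / (1 - s / z) + norm f * norm p * 0"
    using e z by (intro tendsto_intros LIMSEQ_power_zero) auto
  then show ?thesis
    using le by (intro LIMSEQ_le_const) auto
qed

text \<open>\<open>D\<close> extends a vector of the range of \<open>1 - Q\<close> so that the \<open>Q\<close>-component of the eigenvalue
  equation holds; the form \<open>\<lambda>w' w. w' \<bullet> H\<^sub>X (D w)\<close> is the self-energy term of the Schur complement.\<close>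
lemma schur_complement:
  fixes HA HX Q :: "'a::euclidean_space \<Rightarrow> 'a"
  assumes lin: "linear HA" "linear HX" "linear Q"
    and sa: "\<And>p q. HA p \<bullet> q = p \<bullet> HA q" "\<And>p q. HX p \<bullet> q = p \<bullet> HX q" "\<And>p q. Q p \<bullet> q = p \<bullet> Q q"
    and Q: "\<And>p. Q (Q p) = Q p" "\<And>p. norm (Q p) \<le> norm p" "\<And>p. HA (Q p) = 0"
    and HX: "\<And>p. norm (HX p) \<le> e * norm p" and e: "0 \<le> e" "e < z"
    and top: "\<And>p. p \<bullet> (HA p + HX p) \<le> z * (p \<bullet> p)"
    and eig: "HA \<xi> + HX \<xi> = z *\<^sub>R \<xi>"
  obtains D where "linear D" "\<And>w. z *\<^sub>R (D w - w) = Q (HX (D w))"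
    "\<And>w w'. Q w = 0 \<Longrightarrow> Q w' = 0 \<Longrightarrow> w' \<bullet> HX (D w) = w \<bullet> HX (D w')"
    "\<And>w. Q w = 0 \<Longrightarrow> w \<bullet> HA w + w \<bullet> HX (D w) \<le> z * (w \<bullet> w)"
    "D (\<xi> - Q \<xi>) = \<xi>"
proof -
  have linS: "linear (\<lambda>p. Q (HX p))"
    using linear_compose[OF lin(2,3)] by (simp add: o_def)
  have boundS: "norm (Q (HX p)) \<le> e * norm p" for p
    using Q(2)[of "HX p"] HX[of p] by linarith
  obtain D where D: "linear D" "\<And>w. z *\<^sub>R (D w - w) = Q (HX (D w))"
      "\<And>w p. z *\<^sub>R (p - w) = Q (HX p) \<Longrightarrow> p = D w"
    using neumann_solution[OF linS boundS e(2)] by blast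
  \<comment> \<open>\<open>HA\<close> is self-adjoint and kills the range of \<open>Q\<close>, so
    its own range is orthogonal to that of \<open>Q\<close>.\<close>
  have QHA: "Q (HA p) = 0" for p
    using sa(1)[of p "Q (Q (HA p))"] sa(3)[of "HA p" "Q (HA p)"] Q by (simp add: sa(1) inner_commute)
  \<comment> \<open>The correction \<open>D w - w\<close> lies in the range of \<open>Q\<close>, so
    an inner product with it sees only \<open>Q q\<close>.\<close>
  have QD: "(D w - w) \<bullet> q = (D w - w) \<bullet> Q q" if z: "z \<noteq> 0" for w q
  proof -
    have "z *\<^sub>R (Q (D w - w)) = z *\<^sub>R (D w - w)"
      by (simp only: linear_scale[OF lin(3), symmetric] D(2) Q(1))
    then have "Q (D w - w) = D w - w" using z by simp
    then show ?thesis using sa(3)[of "D w - w" q] by simp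
  qed
  have z: "z > 0" using e by simp
  note QD = QD[OF less_imp_neq[OF z, symmetric]]
  show ?thesis
  proof
    show "linear D" "\<And>w. z *\<^sub>R (D w - w) = Q (HX (D w))" by fact+
    show "w' \<bullet> HX (D w) = w \<bullet> HX (D w')" if "Q w = 0" "Q w' = 0" for w w'
    proof -
      \<comment> \<open>In this form both terms on the right are visibly symmetric in
        \<open>a\<close> and \<open>b\<close>.\<close>
      have eq: "a \<bullet> HX (D b) = D a \<bullet> HX (D b) - z * ((D a - a) \<bullet> (D b - b))" for a b
      proof -
        have "(D a - a) \<bullet> HX (D b) = (D a - a) \<bullet> (z *\<^sub>R (D b - b))"
          unfolding D(2) by (rule QD)
        then show ?thesis
          unfolding inner_scaleR_right[symmetric] by (simp only: inner_diff_left)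
      qed
      show ?thesis
        unfolding eq[of w' w] eq[of w w']
        by (metis sa(2) inner_commute)
    qed
    show "w \<bullet> HA w + w \<bullet> HX (D w) \<le> z * (w \<bullet> w)" if w: "Q w = 0" for w
    proof -
      \<comment> \<open>The bound \<open>top\<close> is tested at \<open>D w = w + c\<close>. The
        contribution \<open>c \<bullet> HX (D w) = z * (c \<bullet> c)\<close> cancels against the
        same term of \<open>z\<close> times the squared norm.\<close>
      define c where "c = D w - w"
      have c: "D w = w + c" "c \<bullet> q = c \<bullet> Q q" for q
        using QD by (auto simp: c_def)
      have "c \<bullet> w = 0" using c(2)[of w] w by simp
      moreover have "HA c = 0"
        using QHA c(2) sa(1) by (metis inner_eq_zero_iff inner_zero_right)
      moreover have "c \<bullet> HX (D w) = z * (c \<bullet> c)"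
        unfolding c(2)[of "HX (D w)"] D(2)[symmetric] by (simp add: c_def)
      moreover have "c \<bullet> HA w = 0" using c(2)[of "HA w"] QHA by simp
      ultimately show ?thesis
        using top[of "D w"] by (simp add: c(1) linear_add[OF lin(1)] inner_simps inner_commute distrib_left)
    qed
    have "z *\<^sub>R Q \<xi> = Q (HX \<xi>)"
      using arg_cong[OF eig, of Q]
      by (simp add: linear_add[OF lin(3)] linear_scale[OF lin(3)] QHA)
    then show "D (\<xi> - Q \<xi>) = \<xi>"
      by (intro D(3)[symmetric]) simp
  qed
qed

section \<open>Standard Gaussian matrices\<close>

definition gaussian_density :: "'a::euclidean_space \<Rightarrow> real" where
  "gaussian_density x = (1 / sqrt (2 * pi)) ^ DIM('a) * exp (- (norm x)\<^sup>2 / 2)"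

lemma gaussian_density_nonneg: "gaussian_density x \<ge> 0"
  by (simp add: gaussian_density_def)

lemma measurable_gaussian_density [measurable]: "gaussian_density \<in> borel_measurable borel"
  unfolding gaussian_density_def by measurable

lemma bij_betw_matrix_Basis:
  "bij_betw (\<lambda>(i, j). axis i (axis j 1)) UNIV (Basis :: (real^'n^'m) set)"
  by (auto simp: bij_betw_def inj_on_def Basis_vec_def axis_eq_axis image_iff)

lemma prod_matrix_Basis:
  fixes X :: "real^'n^'m"
  shows "(\<Prod>b\<in>Basis. f (X \<bullet> b)) = (\<Prod>(i, j)\<in>UNIV. f (X $ i $ j))"
  by (subst prod.reindex_bij_betw[OF bij_betw_matrix_Basis, symmetric])
     (simp add: case_prod_unfold inner_axis)

lemma prod_std_normal_density_Basis:
  fixes x :: "'a::euclidean_space"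
  shows "(\<Prod>b\<in>Basis. std_normal_density (x \<bullet> b)) = gaussian_density x"
proof -
  have "(\<Sum>b\<in>Basis. - (x \<bullet> b)\<^sup>2 / 2) = - (norm x)\<^sup>2 / 2"
    unfolding power2_norm_eq_inner euclidean_inner[of x x]
    by (simp add: power2_eq_square sum_negf sum_divide_distrib)
  then show ?thesis
    by (simp add: std_normal_density_def prod.distrib prod_dividef gaussian_density_def
        exp_sum[symmetric] power_divide)
qed

lemma mem_box_matrix:
  fixes X :: "real^'n^'m"
  shows "X \<in> box l u \<longleftrightarrow> (\<forall>i j. l $ i $ j < X $ i $ j \<and> X $ i $ j < u $ i $ j)"
  by (auto simp: mem_box Basis_vec_def inner_axis)

text \<open>The Lebesgue measure is recognised on boxes after dividing the law by the density,
  which makes every coordinate uniform.\<close>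
lemma standard_gaussian_matrix_distr:
  fixes E :: "'w \<Rightarrow> real^'n^'m"
  assumes "prob_space M" "standard_gaussian_matrix M E"
  shows "E \<in> M \<rightarrow>\<^sub>M borel" and "distr M borel E = density lborel gaussian_density"
proof -
  interpret prob_space M by fact
  have ind: "indep_vars (\<lambda>_. borel) (\<lambda>(i, j) \<omega>. E \<omega> $ i $ j) UNIV"
    and dist: "\<And>i j. distributed M lborel (\<lambda>\<omega>. E \<omega> $ i $ j) std_normal_density"
    using assms(2) by (auto simp: standard_gaussian_matrix_def)
  have meas[measurable]: "(\<lambda>\<omega>. E \<omega> $ i $ j) \<in> borel_measurable M" for i j
    using distributed_measurable[OF dist[of i j]] by simp
  have "(\<lambda>\<omega>. E \<omega> \<bullet> b) \<in> borel_measurable M" if "b \<in> Basis" for b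
    using that by (auto simp: Basis_vec_def inner_axis)
  then show E[measurable]: "E \<in> M \<rightarrow>\<^sub>M borel"
    by (subst borel_measurable_euclidean_space) auto
  let ?g = "\<lambda>X :: real^'n^'m. ennreal (gaussian_density X)"
  have pos: "gaussian_density X > 0" for X :: "real^'n^'m"
    by (simp add: gaussian_density_def)
  define D where "D = density (distr M borel E) (\<lambda>X. ennreal (1 / gaussian_density X))"
  have "lborel = D"
  proof (rule lborel_eqI)
    show "sets D = sets borel" by (simp add: D_def)
    fix l u :: "real^'n^'m" assume lu: "\<And>b. b \<in> Basis \<Longrightarrow> l \<bullet> b \<le> u \<bullet> b"
    have lu': "l $ i $ j \<le> u $ i $ j" for i j
      using lu[of "axis i (axis j 1)"] by (auto simp: inner_axis Basis_vec_def)
    \<comment> \<open>Dividing the indicator of a side of the box by the coordinate density makes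
      its expectation the length of that side.\<close>
    define h where "h = (\<lambda>(i, j) x. ennreal (indicator {l $ i $ j<..<u $ i $ j} x / std_normal_density x))"
    have h_meas[measurable]: "h p \<in> borel_measurable borel" for p
      by (cases p) (simp add: h_def)
    have "emeasure D (box l u) = (\<integral>\<^sup>+\<omega>. ennreal (1 / gaussian_density (E \<omega>)) * indicator (box l u) (E \<omega>) \<partial>M)"
      by (simp add: D_def emeasure_density nn_integral_distr)
    also have "\<dots> = (\<integral>\<^sup>+\<omega>. (\<Prod>p\<in>UNIV. h p (E \<omega> $ fst p $ snd p)) \<partial>M)"
    proof (rule nn_integral_cong)
      fix \<omega>
      have "gaussian_density (E \<omega>) = (\<Prod>p\<in>UNIV. std_normal_density (E \<omega> $ fst p $ snd p))"
        unfolding prod_std_normal_density_Basis[symmetric] prod_matrix_Basis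
        by (simp add: case_prod_unfold)
      moreover have "(indicator (box l u) (E \<omega>) :: real) =
          (\<Prod>p\<in>UNIV. indicator {l $ fst p $ snd p<..<u $ fst p $ snd p} (E \<omega> $ fst p $ snd p))"
        by (auto simp: indicator_def mem_box_matrix prod_zero_iff)
      ultimately have "1 / gaussian_density (E \<omega>) * indicator (box l u) (E \<omega>) =
          (\<Prod>p\<in>UNIV. indicator {l $ fst p $ snd p<..<u $ fst p $ snd p} (E \<omega> $ fst p $ snd p)
            / std_normal_density (E \<omega> $ fst p $ snd p))"
        by (simp add: prod_dividef)
      moreover have "ennreal (1 / gaussian_density (E \<omega>)) * indicator (box l u) (E \<omega>) =
          ennreal (1 / gaussian_density (E \<omega>) * indicator (box l u) (E \<omega>))"
        by (simp split: split_indicator)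
      ultimately show "ennreal (1 / gaussian_density (E \<omega>)) * indicator (box l u) (E \<omega>) =
          (\<Prod>p\<in>UNIV. h p (E \<omega> $ fst p $ snd p))"
        by (simp add: h_def case_prod_unfold prod_ennreal)
    qed
    also have "\<dots> = (\<Prod>p\<in>UNIV. \<integral>\<^sup>+\<omega>. h p (E \<omega> $ fst p $ snd p) \<partial>M)"
    proof (rule indep_vars_nn_integral)
      show "indep_vars (\<lambda>_. borel) (\<lambda>p \<omega>. h p (E \<omega> $ fst p $ snd p)) UNIV"
        using indep_vars_compose2[OF ind, of h "\<lambda>_. borel"] by (simp add: case_prod_unfold)
    qed simp_all
    also have "\<dots> = (\<Prod>p\<in>UNIV. ennreal (u $ fst p $ snd p - l $ fst p $ snd p))"
    proof (rule prod.cong[OF refl])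
      fix p :: "'m \<times> 'n"
      obtain i j where p: "p = (i, j)" by fastforce
      have "(\<integral>\<^sup>+\<omega>. h p (E \<omega> $ i $ j) \<partial>M) = (\<integral>\<^sup>+x. std_normal_density x * h p x \<partial>lborel)"
        by (rule distributed_nn_integral[OF dist, symmetric]) simp
      also have "\<dots> = (\<integral>\<^sup>+x. indicator {l $ i $ j<..<u $ i $ j} x \<partial>lborel)"
        by (rule nn_integral_cong)
           (simp add: h_def p ennreal_mult'[symmetric] normal_density_pos less_imp_neq[symmetric]
             split: split_indicator)
      also have "\<dots> = ennreal (u $ i $ j - l $ i $ j)"
        using lu'[of i j] by simp
      finally show "(\<integral>\<^sup>+\<omega>. h p (E \<omega> $ fst p $ snd p) \<partial>M) = ennreal (u $ fst p $ snd p - l $ fst p $ snd p)"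
        by (simp add: p)
    qed
    also have "\<dots> = ennreal (\<Prod>p\<in>UNIV. (u - l) $ fst p $ snd p)"
      using lu' by (subst prod_ennreal) auto
    also have "(\<Prod>p\<in>UNIV. (u - l) $ fst p $ snd p) = (\<Prod>b\<in>Basis. (u - l) \<bullet> b)"
      unfolding prod_matrix_Basis[of "\<lambda>x. x"] by (simp add: case_prod_unfold)
    finally show "emeasure D (box l u) = (\<Prod>b\<in>Basis. (u - l) \<bullet> b)" .
  qed
  then have "density lborel ?g = density (density (distr M borel E) (\<lambda>X. ennreal (1 / gaussian_density X))) ?g"
    by (simp add: D_def)
  also have "\<dots> = density (distr M borel E) (\<lambda>X. ennreal (1 / gaussian_density X) * ?g X)"
    by (rule density_density_eq) auto
  also have "(\<lambda>X. ennreal (1 / gaussian_density X) * ?g X) = (\<lambda>_. 1)"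
    using pos by (auto simp: fun_eq_iff ennreal_mult''[symmetric] less_imp_neq[symmetric] gaussian_density_nonneg)
  finally show "distr M borel E = density lborel gaussian_density"
    by (simp add: density_1)
qed

section \<open>Shears of Lebesgue measure and Gaussian tail bounds\<close>

lemma nn_integral_lborel_translate:
  fixes f :: "'a::euclidean_space \<Rightarrow> ennreal"
  assumes [measurable]: "f \<in> borel_measurable borel"
  shows "(\<integral>\<^sup>+x. f (c + x) \<partial>lborel) = (\<integral>\<^sup>+x. f x \<partial>lborel)"
proof -
  have "(\<integral>\<^sup>+x. f x \<partial>lborel) = (\<integral>\<^sup>+x. f x \<partial>distr lborel borel ((+) c))"
    by (simp add: lborel_distr_plus)
  also have "\<dots> = (\<integral>\<^sup>+x. f (c + x) \<partial>lborel)"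
    by (subst nn_integral_distr) auto
  finally show ?thesis ..
qed

text \<open>Smearing the point along the fibres of \<open>G\<close> with a unit-mass kernel and using Tonelli
  shows that the shear by \<open>G \<circ> b\<close> can be absorbed by a translation inside each fibre.\<close>
lemma nn_integral_lborel_shear:
  fixes G :: "'c::euclidean_space \<Rightarrow> 'a::euclidean_space" and b :: "'a \<Rightarrow> 'c"
  assumes G: "linear G" and iso: "\<And>c. norm (G c) = norm c"
    and [measurable]: "b \<in> borel \<rightarrow>\<^sub>M borel" "\<phi> \<in> borel_measurable borel"
    and inv: "\<And>x c. b (x + G c) = b x"
  shows "(\<integral>\<^sup>+x. \<phi> (x + G (b x)) \<partial>lborel) = (\<integral>\<^sup>+x. \<phi> x \<partial>lborel)"
proof -
  have bl: "bounded_linear G" "bounded_linear (adjoint G)"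
    using G adjoint_linear[OF G] linear_conv_bounded_linear by auto
  have [measurable]: "G \<in> borel \<rightarrow>\<^sub>M borel" "adjoint G \<in> borel \<rightarrow>\<^sub>M borel"
    using bl by (auto intro!: borel_measurable_continuous_onI linear_continuous_on)
  have inner_G: "G c \<bullet> G d = c \<bullet> d" for c d
    using iso G by (simp add: dot_norm linear_add[OF G, symmetric])
  \<comment> \<open>For an isometry \<open>G\<close> the adjoint is a left inverse, so it reads off
    the coordinate along a fibre.\<close>
  have adj: "adjoint G (x - G c) + c = adjoint G x" for x c
  proof -
    have "adjoint G (G c) = c"
      by (rule vector_eq_rdot[THEN iffD1]) (use adjoint_works[OF G] inner_G in \<open>auto simp: inner_commute\<close>)
    then show ?thesis
      by (simp add: linear_diff[OF adjoint_linear[OF G]])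
  qed
  define \<kappa> where "\<kappa> = (indicator (cbox 0 One) :: 'c \<Rightarrow> ennreal)"
  have [measurable]: "\<kappa> \<in> borel_measurable borel"
    by (simp add: \<kappa>_def)
  have mass: "(\<integral>\<^sup>+c. \<kappa> (a + c) \<partial>lborel) = 1" for a
    by (subst nn_integral_lborel_translate) (auto simp: \<kappa>_def)
  \<comment> \<open>The right-hand side does not mention \<open>d\<close>; using it for
    \<open>b\<close> and for the zero map identifies the two integrals.\<close>
  have smear: "(\<integral>\<^sup>+x. \<phi> (x + G (d x)) \<partial>lborel) =
      (\<integral>\<^sup>+x. \<kappa> (adjoint G x) * (\<integral>\<^sup>+c. \<phi> (x - G c) \<partial>lborel) \<partial>lborel)"
    if [measurable]: "d \<in> borel \<rightarrow>\<^sub>M borel" and dinv: "\<And>x c. d (x + G c) = d x" for d :: "'a \<Rightarrow> 'c"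
  proof -
    have dinv': "d (x - G c) = d x" for x c
      using dinv[of x "- c"] linear_neg[OF G] by simp
    have "(\<integral>\<^sup>+x. \<phi> (x + G (d x)) \<partial>lborel) =
        (\<integral>\<^sup>+x. (\<integral>\<^sup>+c. \<phi> (x + G (d x)) * \<kappa> (adjoint G x + c) \<partial>lborel) \<partial>lborel)"
      by (simp add: nn_integral_cmult mass)
    also have "\<dots> = (\<integral>\<^sup>+c. (\<integral>\<^sup>+x. \<phi> (x + G (d x)) * \<kappa> (adjoint G x + c) \<partial>lborel) \<partial>lborel)"
      by (rule lborel_pair.Fubini'[symmetric]) measurable
    also have "\<dots> = (\<integral>\<^sup>+c. (\<integral>\<^sup>+x. \<phi> (x - G c + G (d x)) * \<kappa> (adjoint G x) \<partial>lborel) \<partial>lborel)"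
    proof (rule nn_integral_cong)
      fix c
      show "(\<integral>\<^sup>+x. \<phi> (x + G (d x)) * \<kappa> (adjoint G x + c) \<partial>lborel) =
          (\<integral>\<^sup>+x. \<phi> (x - G c + G (d x)) * \<kappa> (adjoint G x) \<partial>lborel)"
        by (subst nn_integral_lborel_translate[of _ "- G c", symmetric])
           (auto simp: dinv' adj)
    qed
    also have "\<dots> = (\<integral>\<^sup>+x. (\<integral>\<^sup>+c. \<phi> (x - G c + G (d x)) * \<kappa> (adjoint G x) \<partial>lborel) \<partial>lborel)"
      by (rule lborel_pair.Fubini') measurable
    also have "\<dots> = (\<integral>\<^sup>+x. \<kappa> (adjoint G x) * (\<integral>\<^sup>+c. \<phi> (x - G c) \<partial>lborel) \<partial>lborel)"
    proof (rule nn_integral_cong)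
      fix x
      have "(\<integral>\<^sup>+c. \<phi> (x - G c + G (d x)) \<partial>lborel) = (\<integral>\<^sup>+c. \<phi> (x - G c) \<partial>lborel)"
        by (subst nn_integral_lborel_translate[of _ "d x", symmetric])
           (auto simp: linear_add[OF G] algebra_simps)
      then show "(\<integral>\<^sup>+c. \<phi> (x - G c + G (d x)) * \<kappa> (adjoint G x) \<partial>lborel) =
          \<kappa> (adjoint G x) * (\<integral>\<^sup>+c. \<phi> (x - G c) \<partial>lborel)"
        by (simp add: nn_integral_multc) (simp add: mult.commute)
    qed
    finally show ?thesis .
  qed
  have "(\<integral>\<^sup>+x. \<phi> (x + G (b x)) \<partial>lborel) = (\<integral>\<^sup>+x. \<phi> (x + G ((\<lambda>_. 0) x)) \<partial>lborel)"
    using smear[of b] smear[of "\<lambda>_. 0"] inv by simp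
  then show ?thesis
    using linear_0[OF G] by simp
qed


text \<open>A Cameron-Martin identity with a shift that varies from fibre to fibre: completing the
  square gives the Gaussian density at \<open>x - G (b x)\<close>, and the shear preserves Lebesgue
  measure.\<close>

lemma nn_integral_gaussian_shift:
  fixes G :: "'c::euclidean_space \<Rightarrow> 'a::euclidean_space" and b :: "'a \<Rightarrow> 'c"
  assumes G: "linear G" and iso: "\<And>c. norm (G c) = norm c"
    and [measurable]: "b \<in> borel \<rightarrow>\<^sub>M borel"
    and inv: "\<And>x c. b (x + G c) = b x"
    and mass: "(\<integral>\<^sup>+x. gaussian_density (x :: 'a) \<partial>lborel) = 1"
  shows "(\<integral>\<^sup>+x. gaussian_density x * ennreal (exp (x \<bullet> G (b x) - (norm (b x))\<^sup>2 / 2)) \<partial>lborel) = 1"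
proof -
  have "bounded_linear G"
    using G linear_conv_bounded_linear by auto
  then have [measurable]: "G \<in> borel \<rightarrow>\<^sub>M borel"
    by (auto intro!: borel_measurable_continuous_onI linear_continuous_on)
  have "gaussian_density x * ennreal (exp (x \<bullet> G (b x) - (norm (b x))\<^sup>2 / 2)) =
      ennreal (gaussian_density (x + G (- b x)))" for x
  proof -
    have "(norm (x + G (- b x)))\<^sup>2 = (norm x)\<^sup>2 - 2 * (x \<bullet> G (b x)) + (norm (b x))\<^sup>2"
      unfolding linear_neg[OF G] iso[of "b x", symmetric]
      by (simp add: power2_norm_eq_inner algebra_simps inner_commute)
    then show ?thesis
      unfolding gaussian_density_def
      by (simp add: ennreal_mult''[symmetric] exp_add[symmetric] diff_divide_distrib add_divide_distrib)
  qed
  then have "(\<integral>\<^sup>+x. gaussian_density x * ennreal (exp (x \<bullet> G (b x) - (norm (b x))\<^sup>2 / 2)) \<partial>lborel) =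
      (\<integral>\<^sup>+x. gaussian_density (x + G (- b x)) \<partial>lborel)"
    by simp
  also have "\<dots> = (\<integral>\<^sup>+x. gaussian_density (x :: 'a) \<partial>lborel)"
    by (rule nn_integral_lborel_shear[OF G iso]) (use inv in auto)
  finally show ?thesis using mass by simp
qed

text \<open>Given the component of \<open>E\<close> orthogonal to the range of \<open>G\<close>, the
  vector \<open>b (E \<omega>)\<close> is fixed and the inner product is a centred Gaussian of
  standard deviation \<open>norm (b (E \<omega>))\<close>. The shift identity supplies the
  exponential moment for a Chernoff bound without conditional distributions.\<close>

lemma gaussian_matrix_tail:
  fixes E :: "'w \<Rightarrow> real^'n^'m" and G :: "'c::euclidean_space \<Rightarrow> real^'n^'m"
    and b :: "real^'n^'m \<Rightarrow> 'c"
  assumes "prob_space M" "standard_gaussian_matrix M E"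
    and G: "linear G" and iso: "\<And>c. norm (G c) = norm c"
    and b[measurable]: "b \<in> borel \<rightarrow>\<^sub>M borel"
    and inv: "\<And>X c. b (X + G c) = b X"
    and t: "t > 0"
  shows "emeasure M {\<omega>\<in>space M. t * norm (b (E \<omega>)) < \<bar>E \<omega> \<bullet> G (b (E \<omega>))\<bar>} \<le> ennreal (2 * exp (- t\<^sup>2 / 2))"
proof -
  interpret prob_space M by fact
  note law = standard_gaussian_matrix_distr[OF assms(1,2)]
  note [measurable] = law(1)
  have "bounded_linear G"
    using G linear_conv_bounded_linear by auto
  then have [measurable]: "G \<in> borel \<rightarrow>\<^sub>M borel"
    by (auto intro!: borel_measurable_continuous_onI linear_continuous_on)
  have mass: "(\<integral>\<^sup>+x. gaussian_density (x :: real^'n^'m) \<partial>lborel) = 1"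
  proof -
    have "(\<integral>\<^sup>+x. gaussian_density (x :: real^'n^'m) \<partial>lborel) = emeasure (density lborel (gaussian_density :: real^'n^'m \<Rightarrow> real)) UNIV"
      by (subst emeasure_density) auto
    also have "\<dots> = emeasure (distr M borel E) UNIV"
      by (simp add: law(2))
    also have "\<dots> = 1"
      by (subst emeasure_distr) (auto simp: emeasure_space_1)
    finally show ?thesis .
  qed
  \<comment> \<open>Where \<open>b X = 0\<close> the convention for division makes
    \<open>e X = 0\<close>, which is why the length of \<open>d\<close> below is only bounded by
    \<open>t\<close>.\<close>
  define e where "e X = b X /\<^sub>R norm (b X)" for X
  have [measurable]: "e \<in> borel \<rightarrow>\<^sub>M borel"
    unfolding e_def by measurable
  have one_sided: "emeasure M {\<omega>\<in>space M. t < E \<omega> \<bullet> G (s *\<^sub>R e (E \<omega>))} \<le> ennreal (exp (- t\<^sup>2 / 2))"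
    if s: "\<bar>s\<bar> = 1" for s
  proof -
    \<comment> \<open>Length \<open>t\<close> is the optimal Chernoff parameter; the sign
      \<open>s\<close> selects the upper or the lower tail.\<close>
    define d where "d X = (t * s) *\<^sub>R e X" for X
    have [measurable]: "d \<in> borel \<rightarrow>\<^sub>M borel"
      unfolding d_def by measurable
    have dinv: "d (X + G c) = d X" for X c
      by (simp add: d_def e_def inv)
    have nd: "(norm (d X))\<^sup>2 \<le> t\<^sup>2" for X
    proof -
      have "norm (d X) \<le> t"
        using s t by (cases "b X = 0") (simp_all add: d_def e_def abs_mult)
      then show ?thesis by (simp add: power_mono)
    qed
    have "emeasure M {\<omega>\<in>space M. t < E \<omega> \<bullet> G (s *\<^sub>R e (E \<omega>))} =
        (\<integral>\<^sup>+\<omega>. indicator {\<omega>\<in>space M. t < E \<omega> \<bullet> G (s *\<^sub>R e (E \<omega>))} \<omega> \<partial>M)"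
      by (subst nn_integral_indicator) auto
    also have "\<dots> \<le> (\<integral>\<^sup>+\<omega>. ennreal (exp (- t\<^sup>2 / 2)) * ennreal (exp (E \<omega> \<bullet> G (d (E \<omega>)) - (norm (d (E \<omega>)))\<^sup>2 / 2)) \<partial>M)"
    proof (rule nn_integral_mono)
      fix \<omega> assume "\<omega> \<in> space M"
      have "1 \<le> exp (- t\<^sup>2 / 2) * exp (E \<omega> \<bullet> G (d (E \<omega>)) - (norm (d (E \<omega>)))\<^sup>2 / 2)"
        if "t < E \<omega> \<bullet> G (s *\<^sub>R e (E \<omega>))"
      proof -
        have "t * t \<le> t * (E \<omega> \<bullet> G (s *\<^sub>R e (E \<omega>)))"
          using that t by simp
        also have "\<dots> = E \<omega> \<bullet> G (d (E \<omega>))"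
          by (simp add: d_def linear_scale[OF G])
        finally have "- t\<^sup>2 / 2 + (E \<omega> \<bullet> G (d (E \<omega>)) - (norm (d (E \<omega>)))\<^sup>2 / 2) \<ge> 0"
          using nd[of "E \<omega>"] by (simp add: power2_eq_square)
        then show ?thesis
          unfolding exp_add[symmetric] by (subst one_le_exp_iff)
      qed
      then show "indicator {\<omega>\<in>space M. t < E \<omega> \<bullet> G (s *\<^sub>R e (E \<omega>))} \<omega> \<le>
          ennreal (exp (- t\<^sup>2 / 2)) * ennreal (exp (E \<omega> \<bullet> G (d (E \<omega>)) - (norm (d (E \<omega>)))\<^sup>2 / 2))"
        by (auto simp: indicator_def ennreal_mult''[symmetric] simp flip: ennreal_1 intro!: ennreal_leI)
    qed
    also have "\<dots> = ennreal (exp (- t\<^sup>2 / 2)) * (\<integral>\<^sup>+X. ennreal (exp (X \<bullet> G (d X) - (norm (d X))\<^sup>2 / 2)) \<partial>distr M borel E)"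
      by (simp add: nn_integral_cmult nn_integral_distr)
    also have "(\<integral>\<^sup>+X. ennreal (exp (X \<bullet> G (d X) - (norm (d X))\<^sup>2 / 2)) \<partial>distr M borel E) =
        (\<integral>\<^sup>+X. gaussian_density X * ennreal (exp (X \<bullet> G (d X) - (norm (d X))\<^sup>2 / 2)) \<partial>lborel)"
      unfolding law(2) by (subst nn_integral_density) auto
    also have "\<dots> = 1"
      by (rule nn_integral_gaussian_shift[OF G iso _ _ mass]) (auto simp: dinv)
    finally show ?thesis by simp
  qed
  have "{\<omega>\<in>space M. t * norm (b (E \<omega>)) < \<bar>E \<omega> \<bullet> G (b (E \<omega>))\<bar>} \<subseteq>
      {\<omega>\<in>space M. t < E \<omega> \<bullet> G (1 *\<^sub>R e (E \<omega>))} \<union> {\<omega>\<in>space M. t < E \<omega> \<bullet> G ((-1) *\<^sub>R e (E \<omega>))}"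
  proof (safe, goal_cases)
    case (1 \<omega>)
    have pos: "norm (b (E \<omega>)) > 0"
      using 1 linear_0[OF G] by (cases "b (E \<omega>) = 0") auto
    then have "t < \<bar>E \<omega> \<bullet> G (e (E \<omega>))\<bar>"
      using 1 by (simp add: e_def linear_scale[OF G] abs_mult field_simps)
    then show ?case
      using 1 by (auto simp: linear_scale[OF G] linear_neg[OF G] abs_if split: if_splits)
  qed
  then have "emeasure M {\<omega>\<in>space M. t * norm (b (E \<omega>)) < \<bar>E \<omega> \<bullet> G (b (E \<omega>))\<bar>} \<le>
      emeasure M {\<omega>\<in>space M. t < E \<omega> \<bullet> G (1 *\<^sub>R e (E \<omega>))} + emeasure M {\<omega>\<in>space M. t < E \<omega> \<bullet> G ((-1) *\<^sub>R e (E \<omega>))}"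
    by (intro order_trans[OF emeasure_mono emeasure_subadditive]) auto
  also have "\<dots> \<le> ennreal (exp (- t\<^sup>2 / 2)) + ennreal (exp (- t\<^sup>2 / 2))"
    by (intro add_mono one_sided) auto
  finally show ?thesis
    by (simp flip: ennreal_plus)
qed

section \<open>Hermitization\<close>

text \<open>The self-adjoint dilation with off-diagonal blocks \<open>X\<close> and
  \<open>transpose X\<close>; a singular pair of \<open>X\<close> becomes an eigenvector whose
  eigenvalue is the singular value.\<close>

definition hermitization :: "real^'n^'m \<Rightarrow> (real^'m) \<times> (real^'n) \<Rightarrow> (real^'m) \<times> (real^'n)" where
  "hermitization X p = (X *v snd p, transpose X *v fst p)"

lemma linear_hermitization: "linear (hermitization X)"
  by (rule linearI)
     (simp_all add: hermitization_def matrix_vector_right_distrib matrix_vector_mult_scaleR)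

lemma transpose_add: "transpose (X + Y) = transpose X + transpose (Y :: real^'n^'m)"
  by (simp add: transpose_def vec_eq_iff)

lemma hermitization_add: "hermitization (X + Y) p = hermitization X p + hermitization Y p"
  by (simp add: hermitization_def transpose_add matrix_vector_mult_add_rdistrib)

lemma inner_hermitization: "hermitization X p \<bullet> q = p \<bullet> hermitization X q"
  using inner_matrix_vector_mult[of X "snd p" "fst q"] inner_matrix_vector_mult[of X "snd q" "fst p"]
  by (simp add: hermitization_def inner_prod_def inner_commute del: transpose_matrix_vector)

lemma norm_matrix_vector_le_spectral_norm: "norm (X *v v) \<le> spectral_norm X * norm v"
  unfolding spectral_norm_def by (intro onorm matrix_vector_mul_bounded_linear)

lemma spectral_norm_nonneg: "spectral_norm X \<ge> 0"
  unfolding spectral_norm_def by (intro onorm_pos_le matrix_vector_mul_bounded_linear)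

lemma norm_transpose_vector_le_spectral_norm: "norm (transpose X *v u) \<le> spectral_norm X * norm u"
proof (cases "transpose X *v u = 0")
  case False
  let ?y = "transpose X *v u"
  have "(norm ?y)\<^sup>2 = (X *v ?y) \<bullet> u"
    by (simp add: power2_norm_eq_inner inner_matrix_vector_mult)
  also have "\<dots> \<le> norm (X *v ?y) * norm u"
    by (rule norm_cauchy_schwarz)
  also have "\<dots> \<le> spectral_norm X * norm ?y * norm u"
    by (intro mult_right_mono norm_matrix_vector_le_spectral_norm) simp
  finally show ?thesis
    using False by (simp add: power2_eq_square mult.commute mult.left_commute)
qed (simp add: spectral_norm_nonneg)

lemma norm_hermitization_le: "norm (hermitization X p) \<le> spectral_norm X * norm p"
proof -
  have "(norm (hermitization X p))\<^sup>2 = (norm (X *v snd p))\<^sup>2 + (norm (transpose X *v fst p))\<^sup>2"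
    by (simp add: hermitization_def norm_Pair)
  also have "\<dots> \<le> (spectral_norm X * norm (snd p))\<^sup>2 + (spectral_norm X * norm (fst p))\<^sup>2"
    by (intro add_mono power_mono norm_matrix_vector_le_spectral_norm
        norm_transpose_vector_le_spectral_norm) auto
  also have "\<dots> = (spectral_norm X * norm p)\<^sup>2"
    by (simp add: norm_prod_def power_mult_distrib algebra_simps)
  finally show ?thesis
    by (rule power2_le_imp_le) (simp add: spectral_norm_nonneg)
qed

lemma continuous_on_hermitization:
  fixes f :: "real^'n^'m \<Rightarrow> (real^'m) \<times> (real^'n)"
  assumes "continuous_on UNIV f"
  shows "continuous_on UNIV (\<lambda>X. hermitization X (f X))"
  unfolding hermitization_def matrix_vector_mult_def transpose_def
  using assms by (intro continuous_intros) auto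

section \<open>Rank-one matrices and tails of resolvent chains\<close>

definition outer :: "real^'m \<Rightarrow> real^'n \<Rightarrow> real^'n^'m" where
  "outer x y = (\<chi> i j. x $ i * y $ j)"

text \<open>This turns a bilinear form in \<open>X\<close> into a Frobenius inner product, the shape
  in which the Gaussian tail bound applies.\<close>

lemma inner_outer: "X \<bullet> outer x y = x \<bullet> (X *v y)"
  by (simp add: outer_def inner_vec_def matrix_vector_mult_def sum_distrib_left mult_ac)

lemma outer_mult_vector: "outer x y *v v = (y \<bullet> v) *\<^sub>R x"
  by (simp add: outer_def matrix_vector_mult_def inner_vec_def vec_eq_iff sum_distrib_left mult_ac)

lemma transpose_outer: "transpose (outer x y) = outer y x"
  by (simp add: outer_def transpose_def mult.commute)

lemma norm_outer: "norm (outer x y) = norm x * norm y"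
proof -
  have "outer x y \<bullet> outer x y = (x \<bullet> x) * (y \<bullet> y)"
    by (simp add: inner_outer outer_mult_vector mult.commute)
  then show ?thesis
    by (simp add: norm_eq_sqrt_inner real_sqrt_mult)
qed

lemma linear_outer_left: "linear (\<lambda>x. outer x y)" and linear_outer_right: "linear (outer x)"
  by (auto intro!: linearI simp: outer_def vec_eq_iff algebra_simps)

lemma measurable_outer [measurable]:
  "(\<lambda>x. outer x y) \<in> borel \<rightarrow>\<^sub>M borel" "outer x \<in> borel \<rightarrow>\<^sub>M borel"
  by (auto intro!: borel_measurable_continuous_onI linear_continuous_on
      simp: linear_outer_left linear_outer_right linear_conv_bounded_linear[symmetric])

text \<open>Since \<open>w'\<close> is orthogonal to \<open>w\<close> and to the range of \<open>Q\<close>, the vectors \<open>(Q \<circ> H\<^sub>X)\<^sup>k w\<close> do not change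
  when a multiple of the row (or column) direction probed by \<open>w'\<close> is added to \<open>X\<close>; the bilinear
  form below is therefore conditionally Gaussian.\<close>
lemma hermitization_chain_tail:
  fixes E :: "'w \<Rightarrow> real^'n^'m" and Q :: "(real^'m) \<times> (real^'n) \<Rightarrow> (real^'m) \<times> (real^'n)"
  assumes M: "prob_space M" "standard_gaussian_matrix M E"
    and Q: "linear Q" "\<And>p q. Q p \<bullet> q = p \<bullet> Q q" "\<And>p. norm (Q p) \<le> norm p"
    and w': "norm w' = 1" "Q w' = 0" "fst w' = 0 \<or> snd w' = 0"
    and w: "norm w \<le> 1" "w' \<bullet> w = 0"
    and t: "t > 0"
  obtains B where "B \<in> sets M" "emeasure M B \<le> ennreal (2 * exp (- t\<^sup>2 / 2))"
    "\<And>\<omega>. \<omega> \<in> space M - B \<Longrightarrow>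
      \<bar>hermitization (E \<omega>) w' \<bullet> ((\<lambda>p. Q (hermitization (E \<omega>) p)) ^^ k) w\<bar> \<le> t * spectral_norm (E \<omega>) ^ k"
proof -
  define \<zeta> where "\<zeta> j X = ((\<lambda>p. Q (hermitization X p)) ^^ j) w" for j X
  have \<zeta>_Suc: "\<zeta> (Suc j) X = Q (hermitization X (\<zeta> j X))" for j X
    by (simp add: \<zeta>_def)
  have contQ: "continuous_on UNIV Q"
    using Q(1) linear_continuous_on linear_conv_bounded_linear by blast
  have cont: "continuous_on UNIV (\<zeta> j)" for j
  proof (induction j)
    case 0
    then show ?case by (simp add: \<zeta>_def)
  next
    case (Suc j)
    have "continuous_on UNIV (\<lambda>X. Q (hermitization X (\<zeta> j X)))"
      by (rule continuous_on_compose2[OF contQ continuous_on_hermitization[OF Suc]]) auto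
    then show ?case by (simp add: \<zeta>_Suc[abs_def])
  qed
  from this[of k] have "continuous_on UNIV (\<lambda>X. fst (\<zeta> k X))" "continuous_on UNIV (\<lambda>X. snd (\<zeta> k X))"
    by (auto intro!: continuous_on_fst continuous_on_snd)
  then have [measurable]: "(\<lambda>X. fst (\<zeta> k X)) \<in> borel \<rightarrow>\<^sub>M borel" "(\<lambda>X. snd (\<zeta> k X)) \<in> borel \<rightarrow>\<^sub>M borel"
    by (auto intro: borel_measurable_continuous_onI)
  have bound: "norm (\<zeta> k X) \<le> spectral_norm X ^ k" for X
  proof (induction k)
    case 0
    then show ?case using w(1) by (simp add: \<zeta>_def)
  next
    case (Suc k)
    have "norm (\<zeta> (Suc k) X) \<le> spectral_norm X * norm (\<zeta> k X)"
      unfolding \<zeta>_Suc using Q(3) norm_hermitization_le order_trans by blast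
    also have "\<dots> \<le> spectral_norm X * spectral_norm X ^ k"
      using Suc spectral_norm_nonneg by (intro mult_left_mono)
    finally show ?case by simp
  qed
  \<comment> \<open>The start \<open>w\<close> is orthogonal to \<open>w'\<close> by assumption, and
    every later chain vector lies in the range of the self-adjoint \<open>Q\<close>, which kills
    \<open>w'\<close>.\<close>
  have orth: "w' \<bullet> \<zeta> j X = 0" for j X
    using w(2) Q(2)[of w' "hermitization X (\<zeta> (j - 1) X)"] w'(2)
    by (cases j) (auto simp: \<zeta>_Suc, simp add: \<zeta>_def)
  note law = standard_gaussian_matrix_distr[OF M]
  note [measurable] = law(1)
  have sum: "\<zeta> j (X + Y) = \<zeta> j X"
    if Y: "\<And>p. w' \<bullet> p = 0 \<Longrightarrow> Q (hermitization Y p) = 0" for j X Y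
  proof (induction j)
    case 0
    then show ?case by (simp add: \<zeta>_def)
  next
    case (Suc j)
    show ?case
      unfolding \<zeta>_Suc Suc hermitization_add linear_add[OF Q(1)] using Y[OF orth] by simp
  qed
  from w'(3) show ?thesis
  proof
    assume "snd w' = 0"
    then obtain x where w'_eq: "w' = (x, 0)" by (metis prod.collapse)
    then have x: "norm x = 1" "Q (x, 0) = 0" using w' by (auto simp: norm_Pair)
    let ?b = "\<lambda>X. snd (\<zeta> k X)"
    define B where "B = {\<omega>\<in>space M. t * norm (?b (E \<omega>)) < \<bar>E \<omega> \<bullet> outer x (?b (E \<omega>))\<bar>}"
    show ?thesis
    proof (rule that)
      show "B \<in> sets M"
        unfolding B_def by measurable
      show "emeasure M B \<le> ennreal (2 * exp (- t\<^sup>2 / 2))"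
        unfolding B_def
      proof (rule gaussian_matrix_tail[OF M linear_outer_right _ _ _ t])
        show "norm (outer x c) = norm c" for c :: "real^'n" by (simp add: norm_outer x)
        fix X :: "real^'n^'m" and c
        \<comment> \<open>On vectors orthogonal to \<open>(x, 0)\<close> the perturbation
          \<open>outer x c\<close> produces only multiples of \<open>(x, 0)\<close>, and these are
          removed by \<open>Q\<close>.\<close>
        have "Q (hermitization (outer x c) p) = 0" if "w' \<bullet> p = 0" for p
        proof -
          have "hermitization (outer x c) p = (c \<bullet> snd p) *\<^sub>R (x, 0)"
            using that by (simp add: hermitization_def transpose_outer outer_mult_vector w'_eq inner_prod_def)
          then show ?thesis by (simp only: linear_scale[OF Q(1)] x) simp
        qed
        then show "snd (\<zeta> k (X + outer x c)) = snd (\<zeta> k X)"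
          using sum by metis
      qed measurable
      fix \<omega> assume "\<omega> \<in> space M - B"
      then have "\<bar>E \<omega> \<bullet> outer x (?b (E \<omega>))\<bar> \<le> t * norm (?b (E \<omega>))"
        by (auto simp: B_def)
      also have "\<dots> \<le> t * spectral_norm (E \<omega>) ^ k"
        using t bound[of "E \<omega>"] norm_snd_le[of "snd (\<zeta> k (E \<omega>))" "fst (\<zeta> k (E \<omega>))"] by (intro mult_left_mono) auto
      also have "E \<omega> \<bullet> outer x (?b (E \<omega>)) = hermitization (E \<omega>) w' \<bullet> \<zeta> k (E \<omega>)"
        by (simp add: inner_outer hermitization_def w'_eq inner_prod_def dot_lmul_matrix)
      finally show "\<bar>hermitization (E \<omega>) w' \<bullet> ((\<lambda>p. Q (hermitization (E \<omega>) p)) ^^ k) w\<bar> \<le> t * spectral_norm (E \<omega>) ^ k"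
        by (simp add: \<zeta>_def)
    qed
  next
    \<comment> \<open>The same argument with the roles of rows and columns exchanged.\<close>
    assume "fst w' = 0"
    then obtain y where w'_eq: "w' = (0, y)" by (metis prod.collapse)
    then have y: "norm y = 1" "Q (0, y) = 0" using w' by (auto simp: norm_Pair)
    let ?b = "\<lambda>X. fst (\<zeta> k X)"
    define B where "B = {\<omega>\<in>space M. t * norm (?b (E \<omega>)) < \<bar>E \<omega> \<bullet> outer (?b (E \<omega>)) y\<bar>}"
    show ?thesis
    proof (rule that)
      show "B \<in> sets M"
        unfolding B_def by measurable
      show "emeasure M B \<le> ennreal (2 * exp (- t\<^sup>2 / 2))"
        unfolding B_def
      proof (rule gaussian_matrix_tail[OF M linear_outer_left _ _ _ t])
        show "norm (outer c y) = norm c" for c :: "real^'m" by (simp add: norm_outer y)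
        fix X :: "real^'n^'m" and c
        have "Q (hermitization (outer c y) p) = 0" if "w' \<bullet> p = 0" for p
        proof -
          have "hermitization (outer c y) p = (c \<bullet> fst p) *\<^sub>R (0, y)"
            using that by (simp add: hermitization_def transpose_outer outer_mult_vector w'_eq inner_prod_def)
          then show ?thesis by (simp only: linear_scale[OF Q(1)] y) simp
        qed
        then show "fst (\<zeta> k (X + outer c y)) = fst (\<zeta> k X)"
          using sum by metis
      qed measurable
      fix \<omega> assume "\<omega> \<in> space M - B"
      then have "\<bar>E \<omega> \<bullet> outer (?b (E \<omega>)) y\<bar> \<le> t * norm (?b (E \<omega>))"
        by (auto simp: B_def)
      also have "\<dots> \<le> t * spectral_norm (E \<omega>) ^ k"
        using t bound[of "E \<omega>"] norm_fst_le[of "fst (\<zeta> k (E \<omega>))" "snd (\<zeta> k (E \<omega>))"] by (intro mult_left_mono) auto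
      also have "E \<omega> \<bullet> outer (?b (E \<omega>)) y = hermitization (E \<omega>) w' \<bullet> \<zeta> k (E \<omega>)"
        by (simp add: inner_outer hermitization_def w'_eq inner_prod_def inner_commute)
      finally show "\<bar>hermitization (E \<omega>) w' \<bullet> ((\<lambda>p. Q (hermitization (E \<omega>) p)) ^^ k) w\<bar> \<le> t * spectral_norm (E \<omega>) ^ k"
        by (simp add: \<zeta>_def)
    qed
  qed
qed

section \<open>The deterministic perturbation bound\<close>

definition orthonormal :: "'a::real_inner set \<Rightarrow> bool" where
  "orthonormal B \<longleftrightarrow> finite B \<and> pairwise orthogonal B \<and> (\<forall>b\<in>B. norm b = 1)"

text \<open>For orthonormal \<open>B\<close> this is the orthogonal projection onto the complement
  of the span of \<open>B\<close>; it serves as \<open>Q\<close>.\<close>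

definition residual :: "'a::real_inner set \<Rightarrow> 'a \<Rightarrow> 'a" where
  "residual B p = p - (\<Sum>b\<in>B. (p \<bullet> b) *\<^sub>R b)"

lemma orthonormal_inner:
  assumes "orthonormal B" "b \<in> B" "c \<in> B"
  shows "b \<bullet> c = (if b = c then 1 else 0)"
  using assms by (auto simp: orthonormal_def pairwise_def orthogonal_def norm_eq_1)

lemma linear_residual: "linear (residual B)"
  unfolding residual_def
  by (intro linear_compose_sub linear_compose_sum ballI linearI)
     (auto simp: inner_add_left scaleR_add_left)

lemma orthonormal_inner_sum:
  assumes "orthonormal B" "c \<in> B"
  shows "(\<Sum>b\<in>B. f b *\<^sub>R b) \<bullet> c = f c"
proof -
  have "(\<Sum>b\<in>B. f b *\<^sub>R b) \<bullet> c = (\<Sum>b\<in>B. if b = c then f b else 0)"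
    unfolding inner_sum_left
    using orthonormal_inner[OF assms(1) _ assms(2)] by (intro sum.cong) auto
  then show ?thesis
    using assms by (simp add: orthonormal_def)
qed

lemma residual_inner_basis: "orthonormal B \<Longrightarrow> b \<in> B \<Longrightarrow> residual B p \<bullet> b = 0"
  by (simp add: residual_def inner_diff_left orthonormal_inner_sum)

lemma residual_basis: "orthonormal B \<Longrightarrow> b \<in> B \<Longrightarrow> residual B b = 0"
proof -
  assume B: "orthonormal B" "b \<in> B"
  have "(\<Sum>c\<in>B. (b \<bullet> c) *\<^sub>R c) = (\<Sum>c\<in>B. if c = b then b else 0)"
    using B by (intro sum.cong) (auto simp: orthonormal_inner)
  then show ?thesis using B by (simp add: residual_def orthonormal_def)
qed

lemma residual_idem: "orthonormal B \<Longrightarrow> residual B (residual B p) = residual B p"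
  unfolding residual_def[of B "residual B p"] by (simp add: residual_inner_basis)

lemma inner_residual: "residual B p \<bullet> q = p \<bullet> residual B q"
  by (simp add: residual_def inner_diff_left inner_diff_right inner_sum_left inner_sum_right
      inner_commute mult.commute)

lemma norm_residual_le:
  assumes "orthonormal B"
  shows "norm (residual B p) \<le> norm p"
proof (cases "residual B p = 0")
  case False
  have "(norm (residual B p))\<^sup>2 = p \<bullet> residual B p"
    using inner_residual[of B p "residual B p"] residual_idem[OF assms, of p]
    by (simp add: power2_norm_eq_inner)
  also have "\<dots> \<le> norm p * norm (residual B p)"
    by (rule norm_cauchy_schwarz)
  finally show ?thesis
    using False by (simp add: power2_eq_square)
qed simp

lemma residual_eq_0D: "residual B p = 0 \<Longrightarrow> p = (\<Sum>b\<in>B. (p \<bullet> b) *\<^sub>R b)"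
  by (simp add: residual_def)

text \<open>Parseval's identity for a vector in the span of \<open>B\<close>, followed by the
  Cauchy-Schwarz inequality against the constant 1.\<close>

lemma sum_abs_inner_le:
  assumes B: "orthonormal B" and p: "residual B p = 0"
  shows "(\<Sum>b\<in>B. \<bar>p \<bullet> b\<bar>) \<le> sqrt (card B) * norm p"
proof -
  have "p \<bullet> p = p \<bullet> (\<Sum>b\<in>B. (p \<bullet> b) *\<^sub>R b)"
    by (rule arg_cong[OF residual_eq_0D[OF p]])
  also have "\<dots> = (\<Sum>b\<in>B. (p \<bullet> b)\<^sup>2)"
    by (simp add: inner_sum_right power2_eq_square)
  finally have "p \<bullet> p = (\<Sum>b\<in>B. (p \<bullet> b)\<^sup>2)" .
  then have "(norm p)\<^sup>2 = (\<Sum>b\<in>B. \<bar>p \<bullet> b\<bar>\<^sup>2)"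
    by (simp add: power2_norm_eq_inner)
  moreover have "(\<Sum>b\<in>B. 1 * \<bar>p \<bullet> b\<bar>)\<^sup>2 \<le> (\<Sum>b\<in>B. 1\<^sup>2) * (\<Sum>b\<in>B. \<bar>p \<bullet> b\<bar>\<^sup>2)"
    by (rule Cauchy_Schwarz_ineq_sum)
  ultimately have "(\<Sum>b\<in>B. \<bar>p \<bullet> b\<bar>)\<^sup>2 \<le> (sqrt (card B) * norm p)\<^sup>2"
    by (simp add: power_mult_distrib)
  then show ?thesis
    by (rule power2_le_imp_le) simp
qed

text \<open>Both vectors are expanded in \<open>B\<close>; each of the two sums of absolute
  coordinates costs a factor \<open>sqrt (card B)\<close>.\<close>

lemma inner_linear_le_entries:
  assumes B: "orthonormal B" and L: "linear L"
    and entries: "\<And>b c. b \<in> B \<Longrightarrow> c \<in> B \<Longrightarrow> \<bar>b \<bullet> L c\<bar> \<le> \<theta>" and "\<theta> \<ge> 0"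
    and p: "residual B p = 0" and q: "residual B q = 0"
  shows "\<bar>p \<bullet> L q\<bar> \<le> \<theta> * card B * norm p * norm q"
proof -
  have "p \<bullet> L q = (\<Sum>b\<in>B. (p \<bullet> b) *\<^sub>R b) \<bullet> L (\<Sum>c\<in>B. (q \<bullet> c) *\<^sub>R c)"
    using residual_eq_0D[OF p] residual_eq_0D[OF q] by metis
  also have "\<dots> = (\<Sum>b\<in>B. \<Sum>c\<in>B. (p \<bullet> b) * (q \<bullet> c) * (b \<bullet> L c))"
    unfolding inner_sum_left unfolding linear_sum[OF L] inner_sum_right
    by (simp add: linear_scale[OF L] mult_ac)
  also have "\<bar>\<dots>\<bar> \<le> (\<Sum>b\<in>B. \<Sum>c\<in>B. \<bar>p \<bullet> b\<bar> * \<bar>q \<bullet> c\<bar> * \<theta>)"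
    by (intro order_trans[OF sum_abs] sum_mono)
       (use entries in \<open>auto simp: abs_mult intro!: mult_left_mono\<close>)
  also have "\<dots> = \<theta> * ((\<Sum>b\<in>B. \<bar>p \<bullet> b\<bar>) * (\<Sum>c\<in>B. \<bar>q \<bullet> c\<bar>))"
    unfolding sum_product unfolding sum_distrib_left by (intro sum.cong refl) simp
  also have "\<dots> \<le> \<theta> * ((sqrt (card B) * norm p) * (sqrt (card B) * norm q))"
    using \<open>\<theta> \<ge> 0\<close> B p q by (intro mult_left_mono mult_mono sum_abs_inner_le sum_nonneg) auto
  also have "\<dots> = \<theta> * (sqrt (card B) * sqrt (card B)) * norm p * norm q"
    by (simp only: mult_ac)
  finally show ?thesis by simp
qed

section \<open>Block bases and probing pairs\<close>

definition block_basis :: "(real^'m) set \<Rightarrow> (real^'n) set \<Rightarrow> ((real^'m) \<times> (real^'n)) set" where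
  "block_basis U V = (\<lambda>x. (x, 0)) ` U \<union> (\<lambda>y. (0, y)) ` V"

lemma orthonormal_block_basis:
  "orthonormal U \<Longrightarrow> orthonormal V \<Longrightarrow> orthonormal (block_basis U V)"
  by ((auto simp: orthonormal_def block_basis_def pairwise_def orthogonal_def inner_prod_def norm_Pair); blast)

lemma card_block_basis_le:
  assumes "finite U" "finite V"
  shows "card (block_basis U V) \<le> card U + card V"
  unfolding block_basis_def
  by (intro order_trans[OF card_Un_le] add_mono card_image_le assms)

text \<open>Together with \<open>rotation_right\<close> this rotates an orthonormal pair by 45
  degrees. A symmetric bilinear form takes on the rotated pair half the difference of its diagonal
  entries at \<open>b\<close> and \<open>c\<close>.\<close>

definition rotation_left :: "'a::real_vector \<Rightarrow> 'a \<Rightarrow> 'a" where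
  "rotation_left b c = (1 / sqrt 2) *\<^sub>R (b - c)"

definition rotation_right :: "'a::real_vector \<Rightarrow> 'a \<Rightarrow> 'a" where
  "rotation_right b c = (1 / sqrt 2) *\<^sub>R (b + c)"

text \<open>The probing pairs: distinct basis vectors control the off-diagonal entries of the Schur
  complement, rotated pairs from one block control the differences of its diagonal entries.\<close>
definition probing_pairs where
  "probing_pairs B = {(b, c). b \<in> B \<and> c \<in> B \<and> b \<noteq> c} \<union>
    {(rotation_left b c, rotation_right b c) | b c. b \<in> B \<and> c \<in> B \<and> b \<noteq> c \<and>
      (fst b = 0 \<and> fst c = 0 \<or> snd b = 0 \<and> snd c = 0)}"

section \<open>The gap argument\<close>

text \<open>The first hypothesis comes from maximality of \<open>z\<close>, the second from the
  eigenvalue equation. Eliminating the cross term \<open>s * t\<close> between them leaves the gap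
  \<open>s1 - s2 - \<theta>\<close> in front of the common quadratic form, which is at least
  \<open>9 / 20 * s1 * y\<^sup>2\<close>.\<close>

lemma perturbation_arith:
  fixes s1 s2 \<theta> z \<alpha> \<beta> s t y r :: real
  assumes "2 * s * t * (s1 - \<theta>) \<le> (z - \<alpha>) * s\<^sup>2 + (z - \<beta>) * t\<^sup>2"
    and "(z - \<alpha>) * s\<^sup>2 + (z - \<beta>) * t\<^sup>2 \<le> 2 * s2 * s * t + 2 * r * \<theta> * y * sqrt 2"
    and y: "y\<^sup>2 = s\<^sup>2 + t\<^sup>2" "y \<ge> 0" and z: "z - \<alpha> \<ge> 9 / 20 * s1" "z - \<beta> \<ge> 9 / 20 * s1"
    and pos: "s2 \<ge> 0" "s1 > 0" "s1 - s2 > \<theta>" "\<theta> \<ge> 0" "r \<ge> 0"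
  shows "9 / 20 * (s1 - s2 - \<theta>) * y \<le> 2 * sqrt 2 * r * \<theta>"
proof (cases "y = 0")
  case False
  define F where "F = (z - \<alpha>) * s\<^sup>2 + (z - \<beta>) * t\<^sup>2"
  \<comment> \<open>Multiplying by \<open>s1 - \<theta>\<close> lets the first hypothesis replace
    the cross term by \<open>s2 * F\<close>.\<close>
  have "F * (s1 - \<theta>) \<le> (2 * s2 * s * t + 2 * r * \<theta> * y * sqrt 2) * (s1 - \<theta>)"
    using assms by (intro mult_right_mono) (auto simp: F_def)
  also have "\<dots> = s2 * (2 * s * t * (s1 - \<theta>)) + 2 * r * \<theta> * y * sqrt 2 * (s1 - \<theta>)"
    by (simp add: algebra_simps)
  also have "\<dots> \<le> s2 * F + 2 * r * \<theta> * y * sqrt 2 * s1"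
    using assms by (intro add_mono mult_left_mono) (auto simp: F_def)
  finally have 1: "F * (s1 - s2 - \<theta>) \<le> 2 * r * \<theta> * y * sqrt 2 * s1"
    by (simp add: algebra_simps)
  have "9 / 20 * s1 * y\<^sup>2 = 9 / 20 * s1 * s\<^sup>2 + 9 / 20 * s1 * t\<^sup>2"
    by (simp add: y algebra_simps)
  also have "\<dots> \<le> F"
    unfolding F_def using z by (intro add_mono mult_right_mono) auto
  finally have "9 / 20 * s1 * y\<^sup>2 * (s1 - s2 - \<theta>) \<le> F * (s1 - s2 - \<theta>)"
    using pos by (intro mult_right_mono) auto
  have "(s1 * y) * (9 / 20 * (s1 - s2 - \<theta>) * y) \<le> (s1 * y) * (2 * sqrt 2 * r * \<theta>)"
  proof -
    have "(s1 * y) * (9 / 20 * (s1 - s2 - \<theta>) * y) = 9 / 20 * s1 * y\<^sup>2 * (s1 - s2 - \<theta>)"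
      by (simp add: power2_eq_square)
    moreover have "(s1 * y) * (2 * sqrt 2 * r * \<theta>) = 2 * r * \<theta> * y * sqrt 2 * s1"
      by simp
    ultimately show ?thesis
      using 1 \<open>9 / 20 * s1 * y\<^sup>2 * (s1 - s2 - \<theta>) \<le> F * (s1 - s2 - \<theta>)\<close> by linarith
  qed
  then show ?thesis
    using False pos y by simp
qed (use pos in simp)


lemma orthogonal_complement_range_transpose:
  fixes A :: "real^'n^'m"
  assumes "\<And>b. b \<in> U \<Longrightarrow> x \<bullet> b = 0" "range ((*v) A) \<subseteq> span U"
  shows "transpose A *v x = 0"
proof -
  have "A *v (transpose A *v x) \<in> span U"
    using assms(2) by blast
  then have "orthogonal x (A *v (transpose A *v x))"
    by (rule orthogonal_to_span) (use assms(1) in \<open>simp add: orthogonal_def\<close>)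
  then have "x \<bullet> (A *v (transpose A *v x)) = 0"
    by (simp only: orthogonal_def)
  then have "(transpose A *v x) \<bullet> (transpose A *v x) = 0"
    by (metis inner_commute inner_matrix_vector_mult)
  then show ?thesis by simp
qed

lemma inner_hermitization_self: "p \<bullet> hermitization X p = 2 * (fst p \<bullet> (X *v snd p))"
proof -
  have "snd p \<bullet> (transpose X *v fst p) = fst p \<bullet> (X *v snd p)"
    by (metis inner_commute inner_matrix_vector_mult)
  then show ?thesis
    by (simp add: hermitization_def inner_prod_def)
qed

text \<open>The number \<open>c\<close> is the norm of the part of the pair \<open>(u, v)\<close>
  that lies in the span of \<open>B\<close> but is orthogonal to \<open>u1\<close> and
  \<open>v1\<close> in their blocks; the Schur complement and the gap bound it. The term
  \<open>2 * (e / s1)\<close> covers the part outside the span.\<close>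

lemma perturbed_singular_vectors_close:
  fixes A X :: "real^'n^'m" and U V
  defines "B \<equiv> block_basis U V" and "s1 \<equiv> singular_value A 1" and "s2 \<equiv> singular_value A 2"
    and "e \<equiv> spectral_norm X" and "z \<equiv> singular_value (A + X) 1"
  assumes U: "orthonormal U" "u1 \<in> U" "range ((*v) A) \<subseteq> span U"
    and V: "orthonormal V" "v1 \<in> V" "range ((*v) (transpose A)) \<subseteq> span V"
    and uv1: "unit_singular_vectors A s1 u1 v1"
    and uv: "unit_singular_vectors (A + X) z u v"
    and probe: "\<And>b c k. (b, c) \<in> probing_pairs B \<Longrightarrow>
      \<bar>hermitization X b \<bullet> ((\<lambda>p. residual B (hermitization X p)) ^^ k) c\<bar> \<le> \<tau> * (3 / 2 * e) ^ k"
    and small: "\<tau> > 0" "5000 * \<tau> \<le> s1" "2 * e \<le> s1" "s1 - s2 > 9 * \<tau>"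
  obtains c where "9 / 20 * (s1 - s2 - 9 * \<tau>) * c \<le> sqrt 2 * card B * (9 * \<tau>)"
    "norm (u - (u \<bullet> u1) *\<^sub>R u1) \<le> c + 2 * (e / s1)"
    "norm (v - (v \<bullet> v1) *\<^sub>R v1) \<le> c + 2 * (e / s1)"
proof -
  let ?HA = "hermitization A" and ?HX = "hermitization X" and ?Q = "residual B"
  let ?p = "(u1, 0 :: real^'n)" and ?q = "(0 :: real^'m, v1)"
  define \<xi> where "\<xi> = (u, v)"
  have B: "orthonormal B"
    unfolding B_def using U V orthonormal_block_basis by blast
  have s1: "s1 > 0" using small by linarith
  have e: "e \<ge> 0" unfolding e_def by (rule spectral_norm_nonneg)
  have unit: "norm u1 = 1" "norm v1 = 1" "norm u = 1" "norm v = 1"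
    using uv1 uv by (auto simp: unit_singular_vectors_def)
  have Au1: "A *v v1 = s1 *\<^sub>R u1" "transpose A *v u1 = s1 *\<^sub>R v1"
    using uv1 by (auto simp: unit_singular_vectors_def)
  have pB: "?p \<in> B" "?q \<in> B"
    using U V by (auto simp: B_def block_basis_def)
  have pq: "?p \<noteq> ?q" "norm ?p = 1" "norm ?q = 1"
    using unit by (auto simp: norm_Pair)
  have HAp: "?HA ?p = s1 *\<^sub>R ?q" "?HA ?q = s1 *\<^sub>R ?p"
    using Au1 by (auto simp: hermitization_def)
  have HAQ: "?HA (?Q p) = 0" for p
  proof -
    have orth: "fst (?Q p) \<bullet> x = 0" if "x \<in> U" for x
      using residual_inner_basis[OF B, of "(x, 0)" p] that by (auto simp: B_def block_basis_def inner_prod_def)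
    have orth': "snd (?Q p) \<bullet> y = 0" if "y \<in> V" for y
      using residual_inner_basis[OF B, of "(0, y)" p] that by (auto simp: B_def block_basis_def inner_prod_def)
    have "transpose A *v fst (?Q p) = 0"
      by (rule orthogonal_complement_range_transpose[OF orth U(3)])
    moreover have "transpose (transpose A) *v snd (?Q p) = 0"
      by (rule orthogonal_complement_range_transpose[OF orth' V(3)])
    ultimately show ?thesis
      by (simp add: hermitization_def zero_prod_def)
  qed
  \<comment> \<open>Testing \<open>A + X\<close> at \<open>u1\<close> and \<open>v1\<close> leaves
    the error \<open>u1 \<bullet> (X *v v1)\<close>, which is the probe of order
    \<open>k = 0\<close> for the two top basis vectors.\<close>
  have zs: "z \<ge> s1 - \<tau>"
  proof -
    have "\<bar>u1 \<bullet> (X *v v1)\<bar> \<le> \<tau>"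
      using probe[of ?p ?q 0] pB pq(1)
      by (auto simp: probing_pairs_def hermitization_def inner_prod_def dot_lmul_matrix)
    moreover have "u1 \<bullet> ((A + X) *v v1) = s1 + u1 \<bullet> (X *v v1)"
      using unit by (simp add: matrix_vector_mult_add_rdistrib Au1 inner_add_right norm_eq_1)
    moreover have "u1 \<bullet> ((A + X) *v v1) \<le> norm u1 * norm ((A + X) *v v1)"
      by (rule norm_cauchy_schwarz)
    moreover have "norm ((A + X) *v v1) \<le> z"
      using norm_matrix_vector_le_singular_value[of "A + X" v1] unit by (simp add: z_def)
    ultimately show ?thesis using unit by simp
  qed
  have z: "z > 0" "z \<ge> 999 / 1000 * s1" "e \<le> 51 / 100 * z" "e < z"
    using zs small s1 e by linarith+
  have top: "p \<bullet> (?HA p + ?HX p) \<le> z * (p \<bullet> p)" for p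
  proof -
    have "fst p \<bullet> ((A + X) *v snd p) \<le> norm (fst p) * (z * norm (snd p))"
      unfolding z_def
      by (intro order_trans[OF norm_cauchy_schwarz] mult_left_mono
          norm_matrix_vector_le_singular_value norm_ge_zero)
    then have "p \<bullet> hermitization (A + X) p \<le> z * (2 * norm (fst p) * norm (snd p))"
      by (simp add: inner_hermitization_self mult_ac)
    also have "\<dots> \<le> z * ((norm (fst p))\<^sup>2 + (norm (snd p))\<^sup>2)"
      using z(1) sum_squares_bound by (intro mult_left_mono) auto
    finally show ?thesis
      by (simp add: hermitization_add inner_prod_def power2_norm_eq_inner)
  qed
  have eig: "?HA \<xi> + ?HX \<xi> = z *\<^sub>R \<xi>"
    using uv unfolding hermitization_add[symmetric]
    by (simp add: \<xi>_def hermitization_def unit_singular_vectors_def)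
  have HX_le: "norm (?HX p) \<le> e * norm p" for p
    unfolding e_def by (rule norm_hermitization_le)
  obtain D where D: "linear D" "\<And>w. z *\<^sub>R (D w - w) = ?Q (?HX (D w))"
      "\<And>w w'. ?Q w = 0 \<Longrightarrow> ?Q w' = 0 \<Longrightarrow> w' \<bullet> ?HX (D w) = w \<bullet> ?HX (D w')"
      "\<And>w. ?Q w = 0 \<Longrightarrow> w \<bullet> ?HA w + w \<bullet> ?HX (D w) \<le> z * (w \<bullet> w)"
      "D (\<xi> - ?Q \<xi>) = \<xi>"
    using schur_complement[OF linear_hermitization linear_hermitization linear_residual
        inner_hermitization inner_hermitization inner_residual residual_idem[OF B]
        norm_residual_le[OF B] HAQ HX_le e z(4) top eig] by blast
  have linL: "linear (\<lambda>w. ?HX (D w))"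
    using linear_compose[OF D(1) linear_hermitization] by (simp add: o_def)
  have linS: "linear (\<lambda>p. ?Q (?HX p))"
    using linear_compose[OF linear_hermitization linear_residual] by (simp add: o_def)
  have boundS: "norm (?Q (?HX p)) \<le> e * norm p" for p
    using norm_residual_le[OF B, of "?HX p"] HX_le[of p] by linarith
  define R where "R b c = b \<bullet> ?HX (D c)" for b c
  have R_add: "R (b + b') c = R b c + R b' c" "R b (c + c') = R b c + R b c'"
    and R_scale: "R (x *\<^sub>R b) c = x * R b c" "R b (x *\<^sub>R c) = x * R b c"
    and R_diff: "R (b - b') c = R b c - R b' c" "R b (c - c') = R b c - R b c'" for b b' c c' x
    by (simp_all add: R_def inner_simps linear_add[OF linL] linear_scale[OF linL] linear_diff[OF linL])
  \<comment> \<open>From \<open>e \<le> 51 / 100 * z\<close> the geometric ratio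
    \<open>(3 / 2 * e) / z\<close> is at most 7/9, so the series costs a factor of at most
    9/2.\<close>
  have R_probe: "\<bar>R b c\<bar> \<le> 9 / 2 * \<tau>" if "(b, c) \<in> probing_pairs B" for b c
  proof -
    have "R b c = ?HX b \<bullet> D c" by (simp add: R_def inner_hermitization)
    also have "\<bar>\<dots>\<bar> \<le> \<tau> / (1 - (3 / 2 * e) / z)"
      by (rule inner_neumann_le[OF linS boundS e z(4) _ _ D(2) probe[OF that]]) (use e z in auto)
    also have "\<dots> \<le> \<tau> / (2 / 9)"
      using small z by (intro divide_left_mono) (auto simp: field_simps)
    finally show ?thesis by simp
  qed
  have QB: "?Q b = 0" if "b \<in> B" for b
    using residual_basis[OF B that] .
  have R_off: "\<bar>R b c\<bar> \<le> 9 * \<tau>" if "b \<in> B" "c \<in> B" "b \<noteq> c" for b c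
    using R_probe[of b c] that small by (auto simp: probing_pairs_def)
  have R_sym: "R b c = R c b" if "?Q b = 0" "?Q c = 0" for b c
    unfolding R_def using D(3) that by blast
  \<comment> \<open>Polarization: the rotated pair probes half of this difference, which doubles 9/2
    to 9.\<close>
  have R_diag: "\<bar>R b b - R c c\<bar> \<le> 9 * \<tau>"
    if "b \<in> B" "c \<in> B" "fst b = 0 \<and> fst c = 0 \<or> snd b = 0 \<and> snd c = 0" for b c
  proof (cases "b = c")
    case False
    have "R (rotation_left b c) (rotation_right b c) = (R b b - R c c) / 2"
      using R_sym[OF QB QB, OF that(1,2)]
      by (simp add: rotation_left_def rotation_right_def R_add R_diff R_scale field_simps)
    moreover have "(rotation_left b c, rotation_right b c) \<in> probing_pairs B"
      using that False unfolding probing_pairs_def by blast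
    ultimately show ?thesis
      using R_probe[of "rotation_left b c" "rotation_right b c"] by auto
  qed (use small in simp)
  \<comment> \<open>A crude bound on the diagonal entries themselves. The dilation exchanges the
    blocks, so \<open>b \<bullet> ?HX b = 0\<close> and only \<open>D b - b\<close> contributes; its
    norm is at most \<open>e / (z - e)\<close>.\<close>
  have R_unit: "R b b \<le> 27 / 50 * z" if "b \<in> {?p, ?q}" for b
  proof -
    have b: "norm b = 1" "b \<bullet> ?HX b = 0"
      using that pq by (auto simp: hermitization_def inner_prod_def)
    have "z * norm (D b - b) = norm (z *\<^sub>R (D b - b))" using z by simp
    also have "\<dots> \<le> e * norm (D b)" unfolding D(2) by (rule boundS)
    also have "\<dots> \<le> e * (1 + norm (D b - b))"
      using e b norm_triangle_ineq[of b "D b - b"] by (intro mult_left_mono) auto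
    finally have 1: "(z - e) * norm (D b - b) \<le> e" by (simp add: algebra_simps)
    have "(49 / 100 * z) * norm (D b - b) \<le> (z - e) * norm (D b - b)"
      using z by (intro mult_right_mono) auto
    with 1 have "(49 / 100 * z) * norm (D b - b) \<le> 51 / 100 * z" using z by linarith
    then have 2: "norm (D b - b) \<le> 51 / 49" using z by (simp add: field_simps)
    have "R b b = ?HX b \<bullet> (D b - b)"
      using b by (simp add: R_def inner_diff_right inner_hermitization)
    also have "\<dots> \<le> norm (?HX b) * norm (D b - b)" by (rule norm_cauchy_schwarz)
    also have "\<dots> \<le> (51 / 100 * z) * (51 / 49)"
      using HX_le[of b] b z 2 by (intro mult_mono) auto
    finally show ?thesis using z by simp
  qed
  define \<alpha> where "\<alpha> = R ?p ?p"
  define \<beta> where "\<beta> = R ?q ?q"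
  \<comment> \<open>One scalar per block: this is the model for the self-energy, correct up to
    \<open>9 * \<tau>\<close> in every entry.\<close>
  define \<Gamma> where "\<Gamma> w = (\<alpha> *\<^sub>R fst w, \<beta> *\<^sub>R snd w)" for w :: "(real^'m) \<times> (real^'n)"
  have lin\<Gamma>: "linear \<Gamma>"
    by (rule linearI) (auto simp: \<Gamma>_def algebra_simps)
  define w where "w = \<xi> - ?Q \<xi>"
  define w2 where "w2 = w - (w \<bullet> ?p) *\<^sub>R ?p - (w \<bullet> ?q) *\<^sub>R ?q"
  have Qw: "?Q w = 0"
    by (simp add: w_def linear_diff[OF linear_residual] residual_idem[OF B])
  have Qw2: "?Q w2 = 0"
    unfolding w2_def linear_diff[OF linear_residual] linear_scale[OF linear_residual] Qw
      QB[OF pB(1)] QB[OF pB(2)] by simp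
  have w2_orth: "w2 \<bullet> ?p = 0" "w2 \<bullet> ?q = 0"
    using pq orthonormal_inner[OF B pB] orthonormal_inner[OF B pB(2) pB(1)]
    by (auto simp: w2_def inner_diff_left norm_eq_1)
  have drop: "w2 \<bullet> (a + x *\<^sub>R ?p + y *\<^sub>R ?q) = w2 \<bullet> a" for a x y
    unfolding inner_add_right inner_scaleR_right w2_orth by simp
  have w_eq: "w = w2 + (w \<bullet> ?p) *\<^sub>R ?p + (w \<bullet> ?q) *\<^sub>R ?q"
    by (simp add: w2_def)
  \<comment> \<open>Diagonal entries are compared with the one at \<open>?p\<close> or
    \<open>?q\<close> in the same block; off-diagonal entries of the model vanish and those of the
    self-energy are small.\<close>
  have near: "\<bar>w2 \<bullet> (?HX (D w) - \<Gamma> w)\<bar> \<le> (9 * \<tau>) * card B * norm w2 * norm w"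
  proof (rule inner_linear_le_entries[OF B _ _ _ Qw2 Qw])
    show "linear (\<lambda>w. ?HX (D w) - \<Gamma> w)" by (rule linear_compose_sub[OF linL lin\<Gamma>])
    show "0 \<le> 9 * \<tau>" using small by simp
    fix b c assume bc: "b \<in> B" "c \<in> B"
    show "\<bar>b \<bullet> (?HX (D c) - \<Gamma> c)\<bar> \<le> 9 * \<tau>"
    proof (cases "b = c")
      case True
      have "b \<bullet> \<Gamma> b = \<alpha> \<and> snd b = 0 \<or> b \<bullet> \<Gamma> b = \<beta> \<and> fst b = 0"
        using bc(1) U(1) V(1)
        by (auto simp: B_def block_basis_def \<Gamma>_def inner_prod_def orthonormal_def norm_eq_1)
      then show ?thesis
        using R_diag[OF bc(1) pB(1)] R_diag[OF bc(1) pB(2)] True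
        by (auto simp: inner_diff_right R_def \<alpha>_def \<beta>_def)
    next
      case False
      have "b \<bullet> \<Gamma> c = 0"
        using bc False orthonormal_inner[OF B bc]
        by (auto simp: B_def block_basis_def \<Gamma>_def inner_prod_def)
      then show ?thesis
        using R_off[OF bc False] by (simp add: inner_diff_right R_def)
    qed
  qed
  define s where "s = norm (fst w2)"
  define t where "t = norm (snd w2)"
  have norm_w2: "(norm w2)\<^sup>2 = s\<^sup>2 + t\<^sup>2"
    by (simp add: norm_prod_def s_def t_def)
  have norm_\<xi>: "norm \<xi> = sqrt 2"
    using unit by (simp add: \<xi>_def norm_Pair)
  have norm_w: "norm w \<le> sqrt 2"
  proof -
    have "(norm w)\<^sup>2 = \<xi> \<bullet> w"
      using inner_residual[of B \<xi> w] Qw by (simp add: power2_norm_eq_inner w_def inner_diff_left)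
    also have "\<dots> \<le> sqrt 2 * norm w"
      using norm_cauchy_schwarz[of \<xi> w] norm_\<xi> by simp
    finally show ?thesis
      by (cases "w = 0") (simp_all add: power2_eq_square)
  qed
  \<comment> \<open>Since \<open>w2\<close> is orthogonal to \<open>?p\<close>, to \<open>?q\<close>
    and to the range of \<open>?Q\<close>, only its own contribution survives in each
    product.\<close>
  have w2_inner: "w2 \<bullet> w = (norm w2)\<^sup>2" "w2 \<bullet> \<xi> = (norm w2)\<^sup>2"
    "w2 \<bullet> \<Gamma> w = \<alpha> * s\<^sup>2 + \<beta> * t\<^sup>2"
  proof -
    show 1: "w2 \<bullet> w = (norm w2)\<^sup>2"
      unfolding power2_norm_eq_inner by (subst w_eq) (rule drop)
    have "w2 \<bullet> ?Q \<xi> = 0"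
      using inner_residual[of B w2 \<xi>] Qw2 by simp
    then show "w2 \<bullet> \<xi> = (norm w2)\<^sup>2"
      using 1 by (simp add: w_def inner_diff_right)
    have "\<Gamma> ?p = \<alpha> *\<^sub>R ?p" "\<Gamma> ?q = \<beta> *\<^sub>R ?q"
      by (auto simp: \<Gamma>_def)
    then have "\<Gamma> w = \<Gamma> w2 + ((w \<bullet> ?p) * \<alpha>) *\<^sub>R ?p + ((w \<bullet> ?q) * \<beta>) *\<^sub>R ?q"
      by (subst w_eq) (simp only: linear_add[OF lin\<Gamma>] linear_scale[OF lin\<Gamma>] scaleR_scaleR)
    then have "w2 \<bullet> \<Gamma> w = w2 \<bullet> \<Gamma> w2"
      by (simp only: drop)
    also have "\<dots> = \<alpha> * s\<^sup>2 + \<beta> * t\<^sup>2"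
      by (simp add: \<Gamma>_def inner_prod_def s_def t_def power2_norm_eq_inner)
    finally show "w2 \<bullet> \<Gamma> w = \<alpha> * s\<^sup>2 + \<beta> * t\<^sup>2" .
  qed
  \<comment> \<open>The second singular value enters here: \<open>snd w2\<close> is orthogonal to
    \<open>v1\<close>.\<close>
  have HAw2: "w2 \<bullet> ?HA \<xi> \<le> 2 * s2 * s * t"
  proof -
    have "?HA \<xi> = ?HA w"
      using HAQ[of \<xi>] by (simp add: w_def linear_diff[OF linear_hermitization])
    also have "\<dots> = ?HA w2 + ((w \<bullet> ?q) * s1) *\<^sub>R ?p + ((w \<bullet> ?p) * s1) *\<^sub>R ?q"
      by (subst w_eq) (simp only: linear_add[OF linear_hermitization]
          linear_scale[OF linear_hermitization] HAp scaleR_scaleR add.assoc add.commute[of "_ *\<^sub>R ?q"])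
    finally have "w2 \<bullet> ?HA \<xi> = w2 \<bullet> ?HA w2"
      by (simp only: drop)
    also have "\<dots> = 2 * (fst w2 \<bullet> (A *v snd w2))"
      by (rule inner_hermitization_self)
    also have "fst w2 \<bullet> (A *v snd w2) \<le> s * (s2 * t)"
    proof -
      have "snd w2 \<bullet> v1 = 0" using w2_orth(2) by (simp add: inner_prod_def)
      then have "norm (A *v snd w2) \<le> s2 * t"
        using norm_matrix_vector_le_second_singular_value[of A u1 v1] uv1
        by (simp add: s1_def s2_def t_def)
      then show ?thesis
        unfolding s_def by (intro order_trans[OF norm_cauchy_schwarz] mult_left_mono) auto
    qed
    finally show ?thesis by (simp add: mult_ac)
  qed
  have main: "9 / 20 * (s1 - s2 - 9 * \<tau>) * norm w2 \<le> 2 * sqrt 2 * (card B / 2) * (9 * \<tau>)"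
  proof (rule perturbation_arith)
    \<comment> \<open>The trial vector has the same block norms as \<open>w2\<close>, so the block
      scalars \<alpha> and \<beta> enter both inequalities through the same quadratic form. They
      cancel out of the comparison without their values being known.\<close>
    let ?w = "s *\<^sub>R ?p + t *\<^sub>R ?q"
    have Qw': "?Q ?w = 0"
      using QB[OF pB(1)] QB[OF pB(2)]
      by (simp add: linear_add[OF linear_residual] linear_scale[OF linear_residual] del: scaleR_Pair add_Pair)
    have 1: "?w \<bullet> ?HA ?w = 2 * s * t * s1"
      using unit by (simp add: inner_hermitization_self Au1 matrix_vector_mult_scaleR norm_eq_1)
    have 2: "R ?w ?w = \<alpha> * s\<^sup>2 + \<beta> * t\<^sup>2 + 2 * s * t * R ?p ?q"
      unfolding R_add R_scale \<alpha>_def \<beta>_def R_sym[OF QB QB, OF pB(2) pB(1)]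
      by (simp add: power2_eq_square algebra_simps)
    have 3: "?w \<bullet> ?w = s\<^sup>2 + t\<^sup>2"
      using unit by (simp add: inner_prod_def norm_eq_1 power2_eq_square)
    have 4: "2 * s * t * R ?p ?q \<ge> 2 * s * t * (- (9 * \<tau>))"
      using R_off[OF pB pq(1)] by (intro mult_left_mono) (auto simp: s_def t_def)
    show "2 * s * t * (s1 - 9 * \<tau>) \<le> (z - \<alpha>) * s\<^sup>2 + (z - \<beta>) * t\<^sup>2"
      using D(4)[OF Qw', folded R_def] 4 unfolding 1 2 3 by (simp add: algebra_simps)
    \<comment> \<open>The eigenvalue equation paired with \<open>w2\<close>, where
      \<open>D w\<close> equals \<xi>.\<close>
    have "z * (norm w2)\<^sup>2 = w2 \<bullet> (?HA \<xi> + ?HX \<xi>)"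
      unfolding eig by (simp add: w2_inner)
    also have "\<dots> = w2 \<bullet> ?HA \<xi> + w2 \<bullet> (?HX (D w) - \<Gamma> w) + w2 \<bullet> \<Gamma> w"
      using D(5) by (simp add: w_def inner_add_right inner_diff_right)
    also have "\<dots> \<le> 2 * s2 * s * t + (9 * \<tau>) * card B * norm w2 * norm w + (\<alpha> * s\<^sup>2 + \<beta> * t\<^sup>2)"
      using HAw2 near w2_inner by linarith
    also have "(9 * \<tau>) * card B * norm w2 * norm w \<le> (9 * \<tau>) * card B * norm w2 * sqrt 2"
      using norm_w small by (intro mult_left_mono) auto
    finally show "(z - \<alpha>) * s\<^sup>2 + (z - \<beta>) * t\<^sup>2 \<le>
        2 * s2 * s * t + 2 * (card B / 2) * (9 * \<tau>) * norm w2 * sqrt 2"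
      unfolding norm_w2 by (simp add: algebra_simps)
    \<comment> \<open>The constant 9/20 lies just below (1 - 27/50) * 999/1000.\<close>
    show "z - \<alpha> \<ge> 9 / 20 * s1" "z - \<beta> \<ge> 9 / 20 * s1"
      using R_unit[of ?p] R_unit[of ?q] z s1 by (auto simp: \<alpha>_def \<beta>_def)
    show "(norm w2)\<^sup>2 = s\<^sup>2 + t\<^sup>2" by (rule norm_w2)
  qed (use small s1 in \<open>auto simp: s2_def singular_value_nonneg\<close>)
  \<comment> \<open>The \<open>?Q\<close>-component of the eigenvalue equation gives
    \<open>z * norm (?Q \<xi>) \<le> e * sqrt 2\<close>. The slack between \<open>sqrt 2\<close> and
    2 absorbs the difference between \<open>z\<close> and \<open>s1\<close>.\<close>
  have Q\<xi>: "norm (?Q \<xi>) \<le> 2 * (e / s1)"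
  proof -
    have "z *\<^sub>R ?Q \<xi> = ?Q (?HX \<xi>)"
      using D(2)[of w] D(5) by (simp add: w_def)
    then have "z * norm (?Q \<xi>) \<le> e * sqrt 2"
      using boundS[of \<xi>] norm_\<xi> z by (metis abs_of_pos norm_scaleR)
    moreover have "999 / 1000 * s1 * norm (?Q \<xi>) \<le> z * norm (?Q \<xi>)"
      using z by (intro mult_right_mono) auto
    moreover have "e * sqrt 2 \<le> e * (3 / 2)"
      using e by (intro mult_left_mono real_le_lsqrt) (auto simp: power2_eq_square)
    ultimately have "999 / 1000 * s1 * norm (?Q \<xi>) \<le> e * (3 / 2)" by linarith
    then have "s1 * norm (?Q \<xi>) \<le> 2 * e" using e by linarith
    then show ?thesis using s1 by (simp add: field_simps)
  qed
  have decomp: "\<xi> - (\<xi> \<bullet> ?p) *\<^sub>R ?p - (\<xi> \<bullet> ?q) *\<^sub>R ?q = w2 + ?Q \<xi>"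
  proof -
    have "w \<bullet> b = \<xi> \<bullet> b" if "b \<in> B" for b
      using residual_inner_basis[OF B that] by (simp add: w_def inner_diff_left)
    then show ?thesis
      using pB by (simp add: w2_def w_def)
  qed
  have norm_decomp: "norm (w2 + ?Q \<xi>) \<le> norm w2 + 2 * (e / s1)"
    using norm_triangle_ineq[of w2 "?Q \<xi>"] Q\<xi> by linarith
  show ?thesis
  proof (rule that)
    show "9 / 20 * (s1 - s2 - 9 * \<tau>) * norm w2 \<le> sqrt 2 * card B * (9 * \<tau>)"
      using main by simp
    have "u - (u \<bullet> u1) *\<^sub>R u1 = fst (w2 + ?Q \<xi>)" "v - (v \<bullet> v1) *\<^sub>R v1 = snd (w2 + ?Q \<xi>)"
      unfolding decomp[symmetric] by (simp_all add: \<xi>_def inner_prod_def)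
    moreover have "norm (fst x) \<le> norm x" "norm (snd x) \<le> norm x" for x :: "(real^'m) \<times> (real^'n)"
      by (metis norm_fst_le prod.collapse) (metis norm_snd_le prod.collapse)
    ultimately show "norm (u - (u \<bullet> u1) *\<^sub>R u1) \<le> norm w2 + 2 * (e / s1)"
      "norm (v - (v \<bullet> v1) *\<^sub>R v1) \<le> norm w2 + 2 * (e / s1)"
      using norm_decomp order_trans by metis+
  qed
qed

section \<open>The probing event\<close>

text \<open>An orthonormal basis of the part of \<open>S\<close> orthogonal to \<open>u\<close> is
  completed by \<open>u\<close>. In this way the top singular vectors become basis vectors and take
  part in the probing.\<close>

lemma orthonormal_basis_extending:
  fixes S :: "'a::euclidean_space set"
  assumes S: "subspace S" and u: "u \<in> S" "norm u = 1"
  obtains B where "orthonormal B" "u \<in> B" "S \<subseteq> span B" "card B \<le> dim S"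
proof -
  have sub: "subspace (S \<inter> {x. u \<bullet> x = 0})"
    by (intro subspace_inter S subspace_hyperplane)
  obtain B where B: "B \<subseteq> S \<inter> {x. u \<bullet> x = 0}" "pairwise orthogonal B" "\<And>x. x \<in> B \<Longrightarrow> norm x = 1"
      "independent B" "span B = S \<inter> {x. u \<bullet> x = 0}"
    using orthonormal_basis_subspace[OF sub] by metis
  have orth: "pairwise orthogonal (insert u B)"
    using B(1,2) by (auto simp: pairwise_insert orthogonal_def inner_commute)
  have ind: "independent (insert u B)"
  proof (rule pairwise_orthogonal_independent[OF orth])
    show "0 \<notin> insert u B" using B(3) u by force
  qed
  show ?thesis
  proof
    show "orthonormal (insert u B)"
      using orth B(3,4) u independent_imp_finite by (auto simp: orthonormal_def)
    show "card (insert u B) \<le> dim S"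
      using B(1) u by (intro independent_card_le_dim ind) auto
    show "S \<subseteq> span (insert u B)"
    proof
      fix x assume x: "x \<in> S"
      have "x - (u \<bullet> x) *\<^sub>R u \<in> span B"
        unfolding B(5) using x u S by (auto simp: inner_diff_right norm_eq_1 subspace_diff subspace_scale)
      then show "x \<in> span (insert u B)"
        unfolding span_insert by blast
    qed
  qed simp
qed

lemma
  assumes "norm b = 1" "norm c = 1" "b \<bullet> c = (0 :: real)"
  shows norm_rotation_left: "norm (rotation_left b c) = 1"
    and norm_rotation_right: "norm (rotation_right b c) = 1"
    and inner_rotation: "rotation_left b c \<bullet> rotation_right b c = 0"
  using assms unfolding norm_eq_1 rotation_left_def rotation_right_def
  by (simp_all add: inner_simps inner_commute)

lemma
  assumes "finite B"
  shows finite_probing_pairs: "finite (probing_pairs B)"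
    and card_probing_pairs: "card (probing_pairs B) \<le> 2 * (card B)\<^sup>2"
proof -
  let ?f = "\<lambda>(b, c). (rotation_left b c, rotation_right b c)"
  have sub: "probing_pairs B \<subseteq> (B \<times> B) \<union> ?f ` (B \<times> B)"
    by (auto simp: probing_pairs_def)
  have fin: "finite ((B \<times> B) \<union> ?f ` (B \<times> B))"
    using assms by simp
  show "finite (probing_pairs B)"
    using sub fin by (rule finite_subset)
  have "card (probing_pairs B) \<le> card (B \<times> B) + card (?f ` (B \<times> B))"
    using card_mono[OF fin sub] card_Un_le order_trans by blast
  also have "card (?f ` (B \<times> B)) \<le> card (B \<times> B)"
    using assms by (intro card_image_le) simp
  finally show "card (probing_pairs B) \<le> 2 * (card B)\<^sup>2"
    by (simp add: card_cartesian_product power2_eq_square)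
qed

text \<open>Both kinds of pairs satisfy the orthogonality conditions of the chain bound. A rotated
  vector stays in one block because rotations are only taken within a block.\<close>

lemma probing_pairs_chain_tail:
  fixes E :: "'w \<Rightarrow> real^'n^'m" and U V
  defines "B \<equiv> block_basis U V"
  assumes M: "prob_space M" "standard_gaussian_matrix M E"
    and U: "orthonormal U" and V: "orthonormal V" and bc: "(b, c) \<in> probing_pairs B" and t: "t > 0"
  shows "\<exists>S\<in>sets M. emeasure M S \<le> ennreal (2 * exp (- t\<^sup>2 / 2)) \<and>
    (\<forall>\<omega>\<in>space M - S. \<bar>hermitization (E \<omega>) b \<bullet>
      ((\<lambda>p. residual B (hermitization (E \<omega>) p)) ^^ k) c\<bar> \<le> t * spectral_norm (E \<omega>) ^ k)"
proof -
  have B: "orthonormal B"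
    unfolding B_def using U V by (rule orthonormal_block_basis)
  have blocks: "fst x = 0 \<or> snd x = 0" if "x \<in> B" for x
    using that by (auto simp: B_def block_basis_def)
  have "norm b = 1 \<and> residual B b = 0 \<and> (fst b = 0 \<or> snd b = 0) \<and> norm c \<le> 1 \<and> b \<bullet> c = 0"
  proof (cases "b \<in> B \<and> c \<in> B \<and> b \<noteq> c")
    case True
    then show ?thesis
      using B blocks[of b] orthonormal_inner[OF B, of b c] residual_basis[OF B, of b]
      by (auto simp: orthonormal_def)
  next
    case False
    then obtain x y where xy: "b = rotation_left x y" "c = rotation_right x y" "x \<in> B" "y \<in> B" "x \<noteq> y"
        "fst x = 0 \<and> fst y = 0 \<or> snd x = 0 \<and> snd y = 0"
      using bc unfolding probing_pairs_def by blast
    have on: "norm x = 1" "norm y = 1" "x \<bullet> y = 0"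
      using xy B orthonormal_inner[OF B, of x y] by (auto simp: orthonormal_def)
    have "residual B b = 0"
      using xy residual_basis[OF B]
      by (simp add: rotation_left_def linear_scale[OF linear_residual] linear_diff[OF linear_residual])
    then show ?thesis
      using xy norm_rotation_left[OF on] norm_rotation_right[OF on] inner_rotation[OF on]
      by (auto simp: rotation_left_def)
  qed
  then have b: "norm b = 1" "residual B b = 0" "fst b = 0 \<or> snd b = 0" "norm c \<le> 1" "b \<bullet> c = 0"
    by auto
  obtain S where "S \<in> sets M" "emeasure M S \<le> ennreal (2 * exp (- t\<^sup>2 / 2))"
      "\<And>\<omega>. \<omega> \<in> space M - S \<Longrightarrow> \<bar>hermitization (E \<omega>) b \<bullet>
        ((\<lambda>p. residual B (hermitization (E \<omega>) p)) ^^ k) c\<bar> \<le> t * spectral_norm (E \<omega>) ^ k"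
    by (rule hermitization_chain_tail[OF M linear_residual inner_residual norm_residual_le[OF B] b t,
          where k = k]) blast
  then show ?thesis by blast
qed

text \<open>Thresholds growing like \<open>(3 / 2) ^ k\<close> make the failure probabilities
  summable over all \<open>k\<close>, so that one event serves the whole Neumann series at every
  \<open>z\<close>. The growth is paid for by the factor 3/2 on the spectral norm.\<close>

lemma exists_probing_event:
  fixes E :: "'w \<Rightarrow> real^'n^'m" and U V
  defines "B \<equiv> block_basis U V"
  assumes M: "prob_space M" "standard_gaussian_matrix M E"
    and U: "orthonormal U" and V: "orthonormal V" and L: "exp (- L) \<le> 1 / 2"
  obtains F where "F \<in> sets M" "measure M F \<ge> 1 - 8 * (card B)\<^sup>2 * exp (- L)"
    "\<And>\<omega> b c k. \<omega> \<in> F \<Longrightarrow> (b, c) \<in> probing_pairs B \<Longrightarrow>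
      \<bar>hermitization (E \<omega>) b \<bullet> ((\<lambda>p. residual B (hermitization (E \<omega>) p)) ^^ k) c\<bar>
        \<le> sqrt (2 * L) * (3 / 2 * spectral_norm (E \<omega>)) ^ k"
proof -
  interpret prob_space M by fact
  have "L > 0"
  proof (rule ccontr)
    assume "\<not> L > 0"
    then have "exp (- L) \<ge> 1" by simp
    with L show False by linarith
  qed
  define t where "t k = sqrt (2 * L) * (3 / 2) ^ k" for k :: nat
  have t_pos: "t k > 0" for k
    using \<open>L > 0\<close> by (simp add: t_def)
  define q where "q = exp (- L)"
  have q: "0 < q" "q \<le> 1 / 2" using L by (auto simp: q_def)
  \<comment> \<open>Squaring the threshold gives growth \<open>(9 / 4) ^ k\<close>, which
    Bernoulli's inequality bounds below by \<open>k + 1\<close>.\<close>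
  have t_tail: "exp (- (t k)\<^sup>2 / 2) \<le> q ^ Suc k" for k
  proof -
    have "1 + real k * (5 / 4) \<le> (1 + 5 / 4) ^ k"
      by (rule Bernoulli_inequality) simp
    then have "real (Suc k) \<le> (9 / 4) ^ k" by simp
    then have "L * real (Suc k) \<le> L * (9 / 4) ^ k"
      using \<open>L > 0\<close> by (intro mult_left_mono) auto
    also have "L * (9 / 4) ^ k = (t k)\<^sup>2 / 2"
    proof -
      have "((3 / 2 :: real) ^ k)\<^sup>2 = (9 / 4) ^ k"
        by (simp add: power2_eq_square power_mult_distrib[symmetric])
      then show ?thesis
        using \<open>L > 0\<close> by (simp add: t_def power_mult_distrib)
    qed
    finally have "exp (- (t k)\<^sup>2 / 2) \<le> exp (- (L * real (Suc k)))" by simp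
    also have "\<dots> = q ^ Suc k"
      unfolding q_def exp_of_nat_mult[symmetric] by (simp add: algebra_simps)
    finally show ?thesis .
  qed
  let ?bad = "\<lambda>p k \<omega>. sqrt (2 * L) * (3 / 2 * spectral_norm (E \<omega>)) ^ k <
    \<bar>hermitization (E \<omega>) (fst p) \<bullet> ((\<lambda>p. residual B (hermitization (E \<omega>) p)) ^^ k) (snd p)\<bar>"
  have "\<exists>S\<in>sets M. emeasure M S \<le> ennreal (2 * q ^ Suc k) \<and> (\<forall>\<omega>\<in>space M - S. \<not> ?bad p k \<omega>)"
    if p: "p \<in> probing_pairs B" for p k
  proof -
    obtain S where S: "S \<in> sets M" "emeasure M S \<le> ennreal (2 * exp (- (t k)\<^sup>2 / 2))"
        "\<forall>\<omega>\<in>space M - S. \<bar>hermitization (E \<omega>) (fst p) \<bullet>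
          ((\<lambda>p. residual B (hermitization (E \<omega>) p)) ^^ k) (snd p)\<bar> \<le> t k * spectral_norm (E \<omega>) ^ k"
      using probing_pairs_chain_tail[OF M U V, of "fst p" "snd p" "t k" k] p t_pos[of k]
      by (auto simp: B_def)
    have "t k * spectral_norm X ^ k = sqrt (2 * L) * (3 / 2 * spectral_norm X) ^ k" for X :: "real^'n^'m"
      by (simp only: t_def power_mult_distrib mult.assoc)
    moreover have "emeasure M S \<le> ennreal (2 * q ^ Suc k)"
      using S(2) t_tail[of k] by (intro order_trans[OF S(2)] ennreal_leI) simp
    ultimately show ?thesis
      using S by (intro bexI[of _ S]) (auto simp: not_less)
  qed
  then obtain S where S: "\<And>p k. p \<in> probing_pairs B \<Longrightarrow> S p k \<in> sets M"
      "\<And>p k. p \<in> probing_pairs B \<Longrightarrow> emeasure M (S p k) \<le> ennreal (2 * q ^ Suc k)"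
      "\<And>p k \<omega>. p \<in> probing_pairs B \<Longrightarrow> \<omega> \<in> space M - S p k \<Longrightarrow> \<not> ?bad p k \<omega>"
    by metis
  have finB: "finite B"
    using orthonormal_block_basis[OF U V] by (simp add: B_def orthonormal_def)
  define T where "T = (\<Union>p\<in>probing_pairs B. \<Union>k. S p k)"
  have T: "T \<in> sets M"
    unfolding T_def using S(1) finite_probing_pairs[OF finB] by (intro sets.finite_UN sets.countable_UN) auto
  \<comment> \<open>The geometric sum \<open>2 * q / (1 - q)\<close> is at most \<open>4 * q\<close>
    because \<open>q \<le> 1 / 2\<close>; at most \<open>2 * (card B)\<^sup>2\<close> pairs then
    give the total 8.\<close>
  have union_le: "emeasure M (\<Union>k. S p k) \<le> ennreal (4 * q)" if p: "p \<in> probing_pairs B" for p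
  proof -
    have "(\<lambda>k. 2 * q * q ^ k) sums (2 * q * (1 / (1 - q)))"
      using q by (intro sums_mult geometric_sums) auto
    then have sums: "(\<lambda>k. 2 * q ^ Suc k) sums (2 * q * (1 / (1 - q)))"
      by (simp add: mult.assoc)
    have "emeasure M (\<Union>k. S p k) \<le> (\<Sum>k. emeasure M (S p k))"
      using S(1)[OF p] by (intro emeasure_subadditive_countably) auto
    also have "\<dots> \<le> (\<Sum>k. ennreal (2 * q ^ Suc k))"
      using S(2)[OF p] by (intro suminf_le) auto
    also have "\<dots> = ennreal (2 * q * (1 / (1 - q)))"
      using q by (intro suminf_ennreal_eq sums) auto
    also have "\<dots> \<le> ennreal (4 * q)"
      using q by (intro ennreal_leI) (simp add: field_simps)
    finally show ?thesis .
  qed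
  have "emeasure M T \<le> (\<Sum>p\<in>probing_pairs B. emeasure M (\<Union>k. S p k))"
    unfolding T_def
  proof (rule emeasure_subadditive_finite[OF finite_probing_pairs[OF finB]])
    show "(\<lambda>p. \<Union>k. S p k) ` probing_pairs B \<subseteq> sets M"
      by (intro image_subsetI sets.countable_UN) (use S(1) in blast)
  qed
  also have "\<dots> \<le> (\<Sum>p\<in>probing_pairs B. ennreal (4 * q))"
    by (rule sum_mono) (rule union_le)
  also have "\<dots> = ennreal (real (card (probing_pairs B)) * (4 * q))"
    using q by (simp add: ennreal_mult ennreal_of_nat_eq_real_of_nat)
  also have "\<dots> \<le> ennreal (8 * (card B)\<^sup>2 * q)"
  proof (rule ennreal_leI)
    have "real (card (probing_pairs B)) \<le> 2 * (card B)\<^sup>2"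
      using card_probing_pairs[OF finB] by (metis of_nat_le_iff)
    then have "real (card (probing_pairs B)) * (4 * q) \<le> 2 * (card B)\<^sup>2 * (4 * q)"
      using q by (intro mult_right_mono) auto
    then show "real (card (probing_pairs B)) * (4 * q) \<le> 8 * (card B)\<^sup>2 * q" by simp
  qed
  finally have "measure M T \<le> 8 * (card B)\<^sup>2 * q"
    unfolding emeasure_eq_measure using q by (subst (asm) ennreal_le_iff) auto
  then have "measure M (space M - T) \<ge> 1 - 8 * (card B)\<^sup>2 * q"
    using prob_compl[OF T] by simp
  moreover have "space M - T \<in> sets M" using T by auto
  ultimately show ?thesis
  proof (intro that[of "space M - T"])
    fix \<omega> b c k assume "\<omega> \<in> space M - T" "(b, c) \<in> probing_pairs B"
    then have "\<not> ?bad (b, c) k \<omega>"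
      by (intro S(3)) (auto simp: T_def)
    then show "\<bar>hermitization (E \<omega>) b \<bullet> ((\<lambda>p. residual B (hermitization (E \<omega>) p)) ^^ k) c\<bar>
        \<le> sqrt (2 * L) * (3 / 2 * spectral_norm (E \<omega>)) ^ k"
      by (simp add: not_less)
  qed (simp_all add: q_def)
qed

section \<open>From norms to angles, and the final assembly\<close>

text \<open>For unit vectors both sides are the distance from \<open>y\<close> to the line through
  \<open>x\<close>, with square \<open>1 - (x \<bullet> y)\<^sup>2\<close>.\<close>

lemma sin_line_angle:
  assumes "norm x = 1" "norm y = 1"
  shows "sin (line_angle x y) = norm (y - (y \<bullet> x) *\<^sub>R x)"
proof -
  have "\<bar>x \<bullet> y\<bar> \<le> 1"
    using Cauchy_Schwarz_ineq2[of x y] assms by simp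
  then have "sin (line_angle x y) = sqrt (1 - (x \<bullet> y)\<^sup>2)"
    using assms by (simp add: line_angle_def sin_arccos_abs)
  also have "1 - (x \<bullet> y)\<^sup>2 = (norm (y - (y \<bullet> x) *\<^sub>R x))\<^sup>2"
    using assms unfolding power2_norm_eq_inner norm_eq_1
    by (simp add: inner_diff_left inner_diff_right inner_commute power2_eq_square)
  finally show ?thesis by simp
qed

text \<open>The lower bound on \<delta> makes the correction \<open>9 * (sqrt 2 * G)\<close> at most
  half of \<delta>, which leads to \<open>c * \<delta> \<le> 160 * (r * G)\<close>, well within
  \<open>54\<^sup>2\<close>.\<close>

lemma sine_bound_arith:
  fixes \<delta> G c r :: real
  assumes "9 / 20 * (\<delta> - 9 * (sqrt 2 * G)) * c \<le> sqrt 2 * k * (9 * (sqrt 2 * G))"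
    and "k \<le> 2 * r" "r \<ge> 1" "G > 0" "\<delta> \<ge> 5400 * r * G"
  shows "c \<le> 54\<^sup>2 * (r * G / \<delta>)"
proof -
  have rG: "r * G \<ge> G" using assms by simp
  then have \<delta>: "\<delta> > 0" "\<delta> \<ge> 5400 * G" using assms by linarith+
  have sqrt2: "sqrt 2 \<le> 3 / 2" by (rule real_le_lsqrt) (auto simp: power2_eq_square)
  show ?thesis
  proof (cases "c \<le> 0")
    case True
    then show ?thesis using \<delta> rG assms by (smt (verit) divide_nonneg_pos zero_le_mult_iff zero_le_power2)
  next
    case False
    have "sqrt 2 * G \<le> 3 / 2 * G" using sqrt2 assms by (intro mult_right_mono) auto
    then have "\<delta> / 2 \<le> \<delta> - 9 * (sqrt 2 * G)" using \<delta> assms by linarith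
    then have "9 / 20 * (\<delta> / 2) * c \<le> 9 / 20 * (\<delta> - 9 * (sqrt 2 * G)) * c"
      using False by (intro mult_right_mono mult_left_mono) auto
    also have "\<dots> \<le> sqrt 2 * k * (9 * (sqrt 2 * G))" by fact
    also have "\<dots> = 18 * (k * G)" by simp
    also have "\<dots> \<le> 18 * (2 * r * G)" using assms by (intro mult_left_mono mult_right_mono) auto
    finally have "c * \<delta> \<le> 160 * (r * G)" by (simp add: algebra_simps)
    also have "\<dots> \<le> 54\<^sup>2 * (r * G)" using rG assms by (intro mult_right_mono) auto
    finally show ?thesis using \<delta> by (simp add: field_simps)
  qed
qed

theorem theorem4:
  fixes M :: "'w measure"
    and A :: "real^'n^'m" and E :: "'w \<Rightarrow> real^'n^'m"
    and N n r :: nat and K \<eta> \<sigma>\<^sub>1 \<sigma>\<^sub>2 \<delta>\<^sub>1 :: real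
    and u\<^sub>1 :: "real^'m" and v\<^sub>1 :: "real^'n"
  assumes "prob_space M"
    and "N = CARD('m)" and "n = CARD('n)"
    and "r = rank A" and "r \<ge> 1"
    and "standard_gaussian_matrix M E"
    and "K > 0"
    and "\<eta> = 54 * real r * sqrt ((K + 8) * ln (N + n))"
    and "\<sigma>\<^sub>1 = singular_value A 1" and "\<sigma>\<^sub>2 = singular_value A 2" and "\<delta>\<^sub>1 = \<sigma>\<^sub>1 - \<sigma>\<^sub>2"
    and "\<sigma>\<^sub>1 \<ge> 4 * (sqrt N + sqrt n) + 140 * \<eta> * r"
    and "\<delta>\<^sub>1 \<ge> 100 * \<eta> * r"
    and "(sqrt N + sqrt n)\<^sup>2 / ln (N + n) > 64 * (K + 9)"
    and "unit_singular_vectors A \<sigma>\<^sub>1 u\<^sub>1 v\<^sub>1"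
  shows
    "holds_with_prob_at_least M (1 - 15 * real (N + n) powr (- K))
       (\<lambda>\<omega>. \<forall>u v. unit_singular_vectors (A + E \<omega>) (singular_value (A + E \<omega>) 1) u v \<longrightarrow>
          sin (line_angle u\<^sub>1 u) \<le>
            54\<^sup>2 * sqrt (K + 8) * (r * sqrt (ln (N + n)) / \<delta>\<^sub>1) + 2 * (spectral_norm (E \<omega>) / \<sigma>\<^sub>1)) \<and>
     holds_with_prob_at_least M (1 - 15 * real (N + n) powr (- K))
       (\<lambda>\<omega>. \<forall>u v. unit_singular_vectors (A + E \<omega>) (singular_value (A + E \<omega>) 1) u v \<longrightarrow>
          sin (line_angle v\<^sub>1 v) \<le>
            54\<^sup>2 * sqrt (K + 8) * (r * sqrt (ln (N + n)) / \<delta>\<^sub>1) + 2 * (spectral_norm (E \<omega>) / \<sigma>\<^sub>1))"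
proof -
  \<comment> \<open>With this \<open>L\<close> the tail at threshold \<tau> is
    \<open>2 * exp (- L)\<close>, that is, twice \<open>N + n\<close> to the power
    \<open>- (K + 8)\<close>.\<close>
  define L where "L = (K + 8) * ln (real (N + n))"
  define G where "G = sqrt L"
  define \<tau> where "\<tau> = sqrt (2 * L)"
  have "N \<ge> 1" "n \<ge> 1"
    using assms(2,3) by (simp_all add: Suc_leI)
  then have d: "real (N + n) \<ge> 2" by linarith
  have r: "real r \<ge> 1" "2 * r \<le> N + n"
    using assms(2-5) rank_bound[of A] by simp_all
  have ln: "ln (real (N + n)) > 0" using d by simp
  have L: "L > 0" using ln assms(7) by (simp add: L_def)
  then have G: "G > 0" by (simp add: G_def)
  have \<tau>_eq: "\<tau> = sqrt 2 * G" by (simp add: \<tau>_def G_def real_sqrt_mult)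
  have sqrt2: "sqrt 2 \<le> 3 / 2" by (rule real_le_lsqrt) (auto simp: power2_eq_square)
  have exp_L: "exp (- L) = real (N + n) powr (- (K + 8))"
    using d by (simp add: powr_def L_def algebra_simps)
  have \<eta>: "\<eta> = 54 * real r * G"
    using assms(8) by (simp add: G_def L_def)
  have rrG: "real r * (real r * G) \<ge> real r * G" "real r * G \<ge> G"
    using r G by simp_all
  have \<delta>: "\<delta>\<^sub>1 \<ge> 5400 * real r * G"
  proof -
    have "5400 * (real r * (real r * G)) \<le> \<delta>\<^sub>1"
      using assms(13) by (simp add: \<eta> mult_ac)
    with rrG show ?thesis by simp
  qed
  \<comment> \<open>Here 7560 = 140 * 54; it leaves room for \<open>5000 * \<tau>\<close>, which is
    at most \<open>7500 * G\<close>.\<close>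
  have \<sigma>: "\<sigma>\<^sub>1 \<ge> 7560 * G"
  proof -
    have "\<sigma>\<^sub>1 \<ge> 7560 * (real r * (real r * G))"
    proof -
      have "140 * \<eta> * real r = 7560 * (real r * (real r * G))" by (simp add: \<eta>)
      moreover have "0 \<le> 4 * (sqrt (real N) + sqrt (real n))" by simp
      ultimately show ?thesis using assms(12) by linarith
    qed
    with rrG show ?thesis by linarith
  qed
  have \<tau>: "\<tau> > 0" "\<tau> \<le> 3 / 2 * G"
    using G sqrt2 by (auto simp: \<tau>_eq)
  have small: "5000 * \<tau> \<le> \<sigma>\<^sub>1"
    using \<tau> \<sigma> G by linarith
  have \<sigma>_pos: "\<sigma>\<^sub>1 > 0" using \<sigma> G by linarith
  have Au: "A *v v\<^sub>1 = \<sigma>\<^sub>1 *\<^sub>R u\<^sub>1" "transpose A *v u\<^sub>1 = \<sigma>\<^sub>1 *\<^sub>R v\<^sub>1" and unit: "norm u\<^sub>1 = 1" "norm v\<^sub>1 = 1"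
    using assms(15) by (auto simp: unit_singular_vectors_def)
  \<comment> \<open>The top singular vectors lie in the column and row space because
    \<open>\<sigma>\<^sub>1\<close> is nonzero.\<close>
  have "A *v ((1 / \<sigma>\<^sub>1) *\<^sub>R v\<^sub>1) = u\<^sub>1" "transpose A *v ((1 / \<sigma>\<^sub>1) *\<^sub>R u\<^sub>1) = v\<^sub>1"
    using \<sigma>_pos by (simp_all add: matrix_vector_mult_scaleR Au del: transpose_matrix_vector)
  then have ranges: "u\<^sub>1 \<in> range ((*v) A)" "v\<^sub>1 \<in> range ((*v) (transpose A))"
    by (metis rangeI)+
  have subspaces: "subspace (range ((*v) A))" "subspace (range ((*v) (transpose A)))"
    by (intro linear_subspace_image matrix_vector_mul_linear subspace_UNIV)+
  have dims: "dim (range ((*v) A)) = r" "dim (range ((*v) (transpose A))) = r"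
    using assms(4) rank_dim_range[of A] rank_dim_range[of "transpose A"] rank_transpose[of A]
    by metis+
  obtain U where U: "orthonormal U" "u\<^sub>1 \<in> U" "range ((*v) A) \<subseteq> span U" "card U \<le> r"
    using orthonormal_basis_extending[OF subspaces(1) ranges(1) unit(1)] dims(1) by metis
  obtain V where V: "orthonormal V" "v\<^sub>1 \<in> V" "range ((*v) (transpose A)) \<subseteq> span V" "card V \<le> r"
    using orthonormal_basis_extending[OF subspaces(2) ranges(2) unit(2)] dims(2) by metis
  let ?B = "block_basis U V"
  have card: "card ?B \<le> 2 * r"
    using card_block_basis_le[of U V] U(1,4) V(1,4) by (simp add: orthonormal_def)
  have exp_half: "exp (- L) \<le> 1 / 2"
  proof -
    have "real (N + n) powr (- (K + 8)) \<le> real (N + n) powr (- 1)"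
      using d assms(7) by (intro powr_mono) auto
    also have "\<dots> \<le> 1 / 2"
      using d by (simp add: powr_minus_divide field_simps)
    finally show ?thesis by (simp add: exp_L)
  qed
  obtain F where F: "F \<in> sets M" "measure M F \<ge> 1 - 8 * (card ?B)\<^sup>2 * exp (- L)"
    and probe: "\<And>\<omega> b c k. \<omega> \<in> F \<Longrightarrow> (b, c) \<in> probing_pairs ?B \<Longrightarrow>
      \<bar>hermitization (E \<omega>) b \<bullet> ((\<lambda>p. residual ?B (hermitization (E \<omega>) p)) ^^ k) c\<bar>
        \<le> \<tau> * (3 / 2 * spectral_norm (E \<omega>)) ^ k"
    using exists_probing_event[OF assms(1,6) U(1) V(1) exp_half] unfolding \<tau>_def by blast
  \<comment> \<open>The basis has at most \<open>2 * r \<le> N + n\<close> elements, so the union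
    bound costs a factor \<open>(N + n)\<^sup>2\<close>, absorbed by the 8 in the exponent
    \<open>K + 8\<close>.\<close>
  have prob: "1 - 15 * real (N + n) powr (- K) \<le> measure M F"
  proof -
    have "real (card ?B) \<le> real (N + n)" using card r by linarith
    then have "real ((card ?B)\<^sup>2) \<le> real (N + n) powr 2"
      using d by (simp add: power_mono powr_numeral)
    then have "real ((card ?B)\<^sup>2) * exp (- L) \<le> real (N + n) powr 2 * real (N + n) powr (- (K + 8))"
      unfolding exp_L by (intro mult_right_mono) auto
    also have "\<dots> = real (N + n) powr (- K - 6)"
      unfolding powr_add[symmetric] by (simp add: algebra_simps)
    also have "\<dots> \<le> real (N + n) powr (- K)"
      using d by (intro powr_mono) auto
    finally have "8 * (real ((card ?B)\<^sup>2) * exp (- L)) \<le> 15 * real (N + n) powr (- K)"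
      using powr_ge_zero[of "real (N + n)" "- K"] by linarith
    with F(2) show ?thesis by (simp add: mult.assoc)
  qed
  let ?bound = "\<lambda>\<omega>. 54\<^sup>2 * sqrt (K + 8) * (r * sqrt (ln (N + n)) / \<delta>\<^sub>1) + 2 * (spectral_norm (E \<omega>) / \<sigma>\<^sub>1)"
  have bound_eq: "?bound \<omega> = 54\<^sup>2 * (r * G / \<delta>\<^sub>1) + 2 * (spectral_norm (E \<omega>) / \<sigma>\<^sub>1)" for \<omega>
    by (simp add: G_def L_def real_sqrt_mult)
  have \<delta>_pos: "\<delta>\<^sub>1 > 9 * \<tau>"
    using \<delta> \<tau> rrG G by linarith
  \<comment> \<open>The event \<open>F\<close> was fixed before \<omega>, \<open>u\<close> and
    \<open>v\<close>, so it serves every choice of top singular pair and both angles.\<close>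
  have main: "sin (line_angle u\<^sub>1 u) \<le> ?bound \<omega> \<and> sin (line_angle v\<^sub>1 v) \<le> ?bound \<omega>"
    if \<omega>: "\<omega> \<in> F" and uv: "unit_singular_vectors (A + E \<omega>) (singular_value (A + E \<omega>) 1) u v" for \<omega> u v
  proof (cases "2 * spectral_norm (E \<omega>) \<le> \<sigma>\<^sub>1")
    case True
    have uv_unit: "norm u = 1" "norm v = 1"
      using uv by (auto simp: unit_singular_vectors_def)
    obtain c where c: "9 / 20 * (\<delta>\<^sub>1 - 9 * \<tau>) * c \<le> sqrt 2 * card ?B * (9 * \<tau>)"
      "norm (u - (u \<bullet> u\<^sub>1) *\<^sub>R u\<^sub>1) \<le> c + 2 * (spectral_norm (E \<omega>) / \<sigma>\<^sub>1)"
      "norm (v - (v \<bullet> v\<^sub>1) *\<^sub>R v\<^sub>1) \<le> c + 2 * (spectral_norm (E \<omega>) / \<sigma>\<^sub>1)"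
      using perturbed_singular_vectors_close[OF U(1-3) V(1-3) _ uv probe[OF \<omega>] \<tau>(1)]
        assms(9-11,15) small True \<delta>_pos by metis
    have "c \<le> 54\<^sup>2 * (real r * G / \<delta>\<^sub>1)"
      by (rule sine_bound_arith[OF c(1)[unfolded \<tau>_eq]]) (use card r G \<delta> in auto)
    then show ?thesis
      unfolding bound_eq sin_line_angle[OF unit(1) uv_unit(1)] sin_line_angle[OF unit(2) uv_unit(2)]
      using c by linarith
  next
    case False
    then have "1 \<le> 2 * (spectral_norm (E \<omega>) / \<sigma>\<^sub>1)"
      using \<sigma>_pos by (simp add: field_simps)
    moreover have "54\<^sup>2 * (real r * G / \<delta>\<^sub>1) \<ge> 0"
      using \<delta>_pos \<tau> G by simp
    ultimately have "1 \<le> ?bound \<omega>" unfolding bound_eq by linarith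
    then show ?thesis
      by (intro conjI order_trans[OF sin_le_one])
  qed
  show ?thesis
    unfolding holds_with_prob_at_least_def using F(1) prob main by blast
qed

end
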